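(* Consider the Gaussian random many-access channel with $\ell_n$ users at blocklength $n$, each active independently with probability $\alpha_n$. If $\liminf_{n\to\infty}\alpha_n>0$, then the capacity per unit-energy $\dot C^A$ for the average probability of error (APE) has the following behaviour: 1) If $\ell_n=o(n)$, then $\dot C^A=\frac{\log e}{N_0}$. 2) If $\ell_n=\Omega(n)$, then $\dot C^A=0$.
   Context: Logarithms $\log$ are to base 2. For nonnegative sequences: $a_n=o(b_n)$ means $\lim a_n/b_n=0$; $a_n=\Omega(b_n)$ means $\liminf a_n/b_n>0$. Channel. At blocklength $n$ there are $\ell_n$ users (a positive integer depending on $n$), and $\alpha_n\in(0,1]$. The messages $W_1,\ldots,W_{\ell_n}$ are independent, with $\Pr\{W_i=0\}=1-\alpha_n$ (user $i$ inactive) and $\Pr\{W_i=w\}=\alpha_n/M_n$ for $w\in\{1,\ldots,M_n\}$. User $i$ sends a codeword $\mathbf{x}_i(W_i)\in\mathbb{R}^n$ and the receiver observes $\mathbf{Y}=\sum_{i=1}^{\ell_n}\mathbf{x}_i(W_i)+\mathbf{Z}$, where $\mathbf{Z}$ has $n$ i.i.d. $\mathcal{N}(0,N_0/2)$ components, independent of the messages; $N_0>0$ is fixed. Codes for APE. A symmetric $(n,M_n,E_n,\epsilon)$ code for APE consists of encoding functions $w\mapsto\mathbf{x}_i(w)$ on $\{0,1,\ldots,M_n\}$, $i=1,\ldots,\ell_n$ (one codebook per user), with $\mathbf{x}_i(0)=\mathbf{0}$ and $\sum_{j=1}^n x_{ij}(w)^2\le E_n$ for all $w$, and a decoding function mapping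 $\mathbf{Y}$ to $(\hat W_1,\ldots,\hat W_{\ell_n})\in\{0,1,\ldots,M_n\}^{\ell_n}$ whose average probability of error satisfies $P_{e,A}^{(n)}=\frac{1}{\ell_n}\sum_{i=1}^{\ell_n}\Pr\{\hat W_i\ne W_i\}\le\epsilon$. A rate per unit-energy $\dot R$ is $\epsilon$-achievable if for every $\delta>0$ there exists $n_0$ such that for every $n\ge n_0$ there is an $(n,M_n,E_n,\epsilon)$ code for APE with $\frac{\log M_n}{E_n}>\dot R-\delta$. It is achievable if it is $\epsilon$-achievable for all $0<\epsilon<1$. $\dot C^A$ is the supremum of all achievable rates per unit-energy. *)

theory Defs
  imports "HOL-Probability.Probability"
begin

text \<open>
  Vectors in \<open>\<real>\<^sup>n\<close> are functions on \<open>{..<n}\<close> (users and components are counted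
  from 0), and \<open>x i w j\<close> is the \<open>j\<close>-th component of the codeword of user \<open>i\<close> for message \<open>w\<close>.
\<close>

definition message_pmf :: "real \<Rightarrow> nat \<Rightarrow> nat pmf" where
  "message_pmf \<alpha> M =
     bernoulli_pmf \<alpha> \<bind> (\<lambda>active. if active then pmf_of_set {1..M} else return_pmf 0)"

lemma pmf_message_pmf:
  assumes "0 \<le> \<alpha>" "\<alpha> \<le> 1" "1 \<le> M"
  shows "pmf (message_pmf \<alpha> M) w =
           (if w = 0 then 1 - \<alpha> else if w \<le> M then \<alpha> / real M else 0)"
  using assms by (auto simp: message_pmf_def pmf_bind indicator_def)

definition messages_pmf :: "real \<Rightarrow> nat \<Rightarrow> nat \<Rightarrow> (nat \<Rightarrow> nat) pmf" where
  "messages_pmf \<alpha> M l = Pi_pmf {..<l} 0 (\<lambda>_. message_pmf \<alpha> M)"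

text \<open>The second parameter of \<open>normal_density\<close> is the standard deviation.\<close>

definition noise :: "real \<Rightarrow> nat \<Rightarrow> (nat \<Rightarrow> real) measure" where
  "noise N0 n = (\<Pi>\<^sub>M j\<in>{..<n}. density lborel (\<lambda>z. ennreal (normal_density 0 (sqrt (N0 / 2)) z)))"

definition received ::
    "nat \<Rightarrow> nat \<Rightarrow> (nat \<Rightarrow> nat \<Rightarrow> nat \<Rightarrow> real) \<Rightarrow> (nat \<Rightarrow> nat) \<Rightarrow> (nat \<Rightarrow> real) \<Rightarrow> nat \<Rightarrow> real" where
  "received n l x W Z = (\<lambda>j\<in>{..<n}. (\<Sum>i<l. x i (W i) j) + Z j)"

definition channel_space :: "real \<Rightarrow> real \<Rightarrow> nat \<Rightarrow> nat \<Rightarrow> nat \<Rightarrow> ((nat \<Rightarrow> nat) \<times> (nat \<Rightarrow> real)) measure" where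
  "channel_space N0 \<alpha> l n M = measure_pmf (messages_pmf \<alpha> M l) \<Otimes>\<^sub>M noise N0 n"

definition user_error_prob ::
    "real \<Rightarrow> real \<Rightarrow> nat \<Rightarrow> nat \<Rightarrow> nat \<Rightarrow> (nat \<Rightarrow> nat \<Rightarrow> nat \<Rightarrow> real) \<Rightarrow>
     ((nat \<Rightarrow> real) \<Rightarrow> nat \<Rightarrow> nat) \<Rightarrow> nat \<Rightarrow> real" where
  "user_error_prob N0 \<alpha> l n M x g i =
     \<P>((W, Z) in channel_space N0 \<alpha> l n M. g (received n l x W Z) i \<noteq> W i)"

definition avg_error_prob ::
    "real \<Rightarrow> real \<Rightarrow> nat \<Rightarrow> nat \<Rightarrow> nat \<Rightarrow> (nat \<Rightarrow> nat \<Rightarrow> nat \<Rightarrow> real) \<Rightarrow>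
     ((nat \<Rightarrow> real) \<Rightarrow> nat \<Rightarrow> nat) \<Rightarrow> real" where
  "avg_error_prob N0 \<alpha> l n M x g = (1 / real l) * (\<Sum>i<l. user_error_prob N0 \<alpha> l n M x g i)"

text \<open>
  The decoder \<open>g\<close> is Borel measurable, so that the error events have a probability.  Requiring
  \<open>E > 0\<close> excludes the undefined quotient \<open>log M / 0\<close>.
\<close>

definition APE_code ::
    "real \<Rightarrow> real \<Rightarrow> nat \<Rightarrow> nat \<Rightarrow> nat \<Rightarrow> real \<Rightarrow> real \<Rightarrow>
     (nat \<Rightarrow> nat \<Rightarrow> nat \<Rightarrow> real) \<Rightarrow> ((nat \<Rightarrow> real) \<Rightarrow> nat \<Rightarrow> nat) \<Rightarrow> bool" where
  "APE_code N0 \<alpha> l n M E \<epsilon> x g \<longleftrightarrow>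
     1 \<le> M \<and> 0 < E \<and>
     (\<forall>i<l. \<forall>j<n. x i 0 j = 0) \<and>
     (\<forall>i<l. \<forall>w\<le>M. (\<Sum>j<n. (x i w j)\<^sup>2) \<le> E) \<and>
     g \<in> (\<Pi>\<^sub>M j\<in>{..<n}. borel) \<rightarrow>\<^sub>M (\<Pi>\<^sub>M i\<in>{..<l}. count_space {0..M}) \<and>
     avg_error_prob N0 \<alpha> l n M x g \<le> \<epsilon>"

lemma error_event_measurable:
  assumes "APE_code N0 \<alpha> l n M E \<epsilon> x g" "i < l"
  shows "{(W, Z) \<in> space (channel_space N0 \<alpha> l n M). g (received n l x W Z) i \<noteq> W i}
           \<in> sets (channel_space N0 \<alpha> l n M)"
proof -
  have g: "g \<in> (\<Pi>\<^sub>M j\<in>{..<n}. borel) \<rightarrow>\<^sub>M (\<Pi>\<^sub>M i\<in>{..<l}. count_space {0..M})"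
    using assms by (simp add: APE_code_def)
  have c: "(\<lambda>v. v i) \<in> (\<Pi>\<^sub>M i\<in>{..<l}. count_space {0..M}) \<rightarrow>\<^sub>M count_space {0..M}"
    using assms by (intro measurable_component_singleton) auto
  have "(\<lambda>p. received n l x (fst p) (snd p)) \<in> channel_space N0 \<alpha> l n M \<rightarrow>\<^sub>M (\<Pi>\<^sub>M j\<in>{..<n}. borel)"
    unfolding received_def
  proof (rule measurable_restrict)
    fix j assume j: "j \<in> {..<n}"
    have Z: "(\<lambda>p. snd p j) \<in> borel_measurable (channel_space N0 \<alpha> l n M)"
      unfolding channel_space_def noise_def
      by (rule measurable_compose[OF measurable_snd])
         (use measurable_component_singleton[OF j,
            of "\<lambda>_. density lborel (\<lambda>z. ennreal (normal_density 0 (sqrt (N0 / 2)) z))"]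
          in simp)
    have "(\<lambda>p. x k (fst p k) j) \<in> borel_measurable (channel_space N0 \<alpha> l n M)" for k
      unfolding channel_space_def
      by (rule measurable_compose[OF measurable_fst]) simp
    with Z show "(\<lambda>p. (\<Sum>k<l. x k (fst p k) j) + snd p j)
        \<in> borel_measurable (channel_space N0 \<alpha> l n M)"
      by simp
  qed
  from measurable_compose[OF measurable_compose[OF this g] c]
  have F: "(\<lambda>p. g (received n l x (fst p) (snd p)) i) \<in> channel_space N0 \<alpha> l n M \<rightarrow>\<^sub>M count_space UNIV"
    by (rule measurable_compose) simp
  have H: "(\<lambda>p. fst p i) \<in> channel_space N0 \<alpha> l n M \<rightarrow>\<^sub>M count_space UNIV"
    unfolding channel_space_def by (rule measurable_compose[OF measurable_fst]) simp
  have "{p \<in> space (channel_space N0 \<alpha> l n M).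
      g (received n l x (fst p) (snd p)) i \<noteq> fst p i} \<in> sets (channel_space N0 \<alpha> l n M)"
    using predE[OF pred_intros_logic(2)[OF measurable_compose_countable[OF _ H,
        of "\<lambda>k p. g (received n l x (fst p) (snd p)) i = k"]]] F
    by (simp add: measurable_compose[OF F])
  then show ?thesis by (simp add: case_prod_unfold)
qed

definition eps_achievable ::
    "real \<Rightarrow> (nat \<Rightarrow> real) \<Rightarrow> (nat \<Rightarrow> nat) \<Rightarrow> real \<Rightarrow> real \<Rightarrow> bool" where
  "eps_achievable N0 \<alpha> l \<epsilon> R \<longleftrightarrow>
     (\<forall>\<delta>>0. \<exists>n0. \<forall>n\<ge>n0. \<exists>M E x g.
        APE_code N0 (\<alpha> n) (l n) n M E \<epsilon> x g \<and> log 2 (real M) / E > R - \<delta>)"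

definition achievable :: "real \<Rightarrow> (nat \<Rightarrow> real) \<Rightarrow> (nat \<Rightarrow> nat) \<Rightarrow> real \<Rightarrow> bool" where
  "achievable N0 \<alpha> l R \<longleftrightarrow> (\<forall>\<epsilon>. 0 < \<epsilon> \<and> \<epsilon> < 1 \<longrightarrow> eps_achievable N0 \<alpha> l \<epsilon> R)"

text \<open>The supremum is taken in the extended reals, where it always exists.\<close>

definition capacity_APE :: "real \<Rightarrow> (nat \<Rightarrow> real) \<Rightarrow> (nat \<Rightarrow> nat) \<Rightarrow> ereal" where
  "capacity_APE N0 \<alpha> l = Sup (ereal ` {R. achievable N0 \<alpha> l R})"

end

theory Submission
  imports Defs
begin

text \<open>
  Converse for few users: given the messages of all other users, a single user remains, whose active
  messages have disjoint decoding regions. Comparing the Gaussian output distributions with the one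
  centred at the zero codeword bounds \<open>ln M\<close> by about \<open>E / N0\<close>, up to terms that are negligible when
  \<open>E\<close> is large; and \<open>E\<close> must be large for small \<open>\<epsilon>\<close>, because two codewords of bounded energy cannot be
  told apart reliably.

  Converse for many users: \<open>ln M\<close> times the expected number of active users decoded correctly is at
  most about \<open>(n / 2) ln (1 + 2 l E / (n N0)) + O(n + l)\<close>. If \<open>l / n\<close> is bounded below this forces
  \<open>ln M = O(sqrt E + 1)\<close>, so at a positive rate per unit-energy \<open>E\<close> stays bounded, which is again
  impossible for small \<open>\<epsilon>\<close>.

  Achievability: if \<open>l = o(n)\<close>, every user gets a private block of \<open>n div l\<close> coordinates and uses
  pulse-position modulation with a threshold decoder. At rate 0 the energy may grow arbitrarily fast,
  so the users can send binary digits of different weights in a single coordinate.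
\<close>

section \<open>Gaussian product measures\<close>

text \<open>Guessing message 0 throughout has average error only \<open>\<alpha> n\<close>. The
  single-user lower bounds on the error therefore come from active users and carry the factor
  \<open>\<alpha> n\<close>; the positive liminf makes them uniform in \<open>n\<close>. In both
  converses the order of choices matters: the assumed rate fixes an energy level \<open>E0\<close>,
  \<open>E0\<close> fixes \<open>\<epsilon>\<close>, and only then is one code taken at one large
  blocklength. Its small error forces \<open>E0 < E\<close>. In the single-user converse this pushes
  the error above \<open>a / 2\<close>; with many users it contradicts \<open>E \<le> E0\<close>.
  Neither mutual information nor Fano's inequality occurs: output laws are compared through
  pointwise inequalities between Gaussian densities. With \<open>t = l / n\<close>, each user's
  share of the logarithmic term in the sum-rate bound is
  \<open>ln (1 + 2 * t * E / N0) / (2 * t)\<close>; after \<open>ln (1 + y) \<le> 2 * sqrt y\<close>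
  it decreases in \<open>t\<close>, so a lower bound on \<open>t\<close> suffices. Rate 0 still
  requires a code: even with \<open>M = 1\<close> the receiver has to detect which of arbitrarily
  many users are active.\<close>

definition gauss :: "nat \<Rightarrow> (nat \<Rightarrow> real) \<Rightarrow> real \<Rightarrow> (nat \<Rightarrow> real) measure" where
  "gauss n c \<sigma> = (\<Pi>\<^sub>M j\<in>{..<n}. density lborel (\<lambda>z. ennreal (normal_density (c j) \<sigma> z)))"

definition gauss_density :: "nat \<Rightarrow> (nat \<Rightarrow> real) \<Rightarrow> real \<Rightarrow> (nat \<Rightarrow> real) \<Rightarrow> real" where
  "gauss_density n c \<sigma> y =
     (1 / sqrt (2 * pi * \<sigma>\<^sup>2)) ^ n * exp (- (\<Sum>j<n. (y j - c j)\<^sup>2) / (2 * \<sigma>\<^sup>2))"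

lemma gauss_density_eq_prod: "gauss_density n c \<sigma> y = (\<Prod>j<n. normal_density (c j) \<sigma> (y j))"
  by (simp add: gauss_density_def normal_density_def prod.distrib exp_sum sum_divide_distrib
      power_one_over prod_dividef flip: sum_negf)

lemma gauss_density_nonneg [simp]: "0 \<le> gauss_density n c \<sigma> y"
  by (simp add: gauss_density_def)

lemma sets_gauss [simp, measurable_cong]: "sets (gauss n c \<sigma>) = sets (\<Pi>\<^sub>M j\<in>{..<n}. borel)"
  unfolding gauss_def by (intro sets_PiM_cong) simp_all

lemma space_gauss: "space (gauss n c \<sigma>) = space (\<Pi>\<^sub>M j\<in>{..<n}. borel)"
  by (rule sets_eq_imp_space_eq) simp

lemma space_borel_PiM: "space (\<Pi>\<^sub>M j\<in>{..<n}. borel) = (PiE {..<n} (\<lambda>_. UNIV))"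
  by (simp add: space_PiM)

lemma prob_space_gauss: "0 < \<sigma> \<Longrightarrow> prob_space (gauss n c \<sigma>)"
  unfolding gauss_def by (intro prob_space_PiM prob_space_normal_density)

lemma gauss_density_measurable [measurable]:
  "gauss_density n c \<sigma> \<in> borel_measurable (\<Pi>\<^sub>M j\<in>{..<n}. borel)"
  unfolding gauss_density_def[abs_def] by measurable

lemma sets_lborel_PiM: "sets (\<Pi>\<^sub>M j\<in>{..<n}. lborel) = sets (\<Pi>\<^sub>M j\<in>{..<n}. borel)"
  by (intro sets_PiM_cong) simp_all

text \<open>A product measure is determined by its values on boxes; there the density factorises and
  the integral splits into one-dimensional ones.\<close>

lemma gauss_eq_density:
  assumes "0 < \<sigma>"
  shows "gauss n c \<sigma> = density (\<Pi>\<^sub>M j\<in>{..<n}. lborel) (\<lambda>y. ennreal (gauss_density n c \<sigma> y))"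
proof -
  have ps: "prob_space (density lborel (\<lambda>z. ennreal (normal_density (c j) \<sigma> z)))" for j
    using assms by (rule prob_space_normal_density)
  interpret L: product_sigma_finite "\<lambda>_::nat. lborel :: real measure"
    by (rule product_sigma_finite.intro) (rule sigma_finite_lborel)
  interpret G: product_sigma_finite "\<lambda>j. density lborel (\<lambda>z. ennreal (normal_density (c j) \<sigma> z))"
    by (rule product_sigma_finite.intro) (rule prob_space_imp_sigma_finite[OF ps])
  have m: "(\<lambda>y. ennreal (gauss_density n c \<sigma> y)) \<in> borel_measurable (\<Pi>\<^sub>M j\<in>{..<n}. lborel)"
    using gauss_density_measurable by (simp add: measurable_cong_sets[OF sets_lborel_PiM refl])
  have "density (\<Pi>\<^sub>M j\<in>{..<n}. lborel) (\<lambda>y. ennreal (gauss_density n c \<sigma> y)) = gauss n c \<sigma>"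
    unfolding gauss_def
  proof (rule G.PiM_eqI)
    show "sets (density (\<Pi>\<^sub>M j\<in>{..<n}. lborel) (\<lambda>y. ennreal (gauss_density n c \<sigma> y))) =
        sets (\<Pi>\<^sub>M j\<in>{..<n}. density lborel (\<lambda>z. ennreal (normal_density (c j) \<sigma> z)))"
      by (simp, intro sets_PiM_cong) simp_all
  next
    fix A assume "\<And>j. j \<in> {..<n} \<Longrightarrow> A j \<in> sets (density lborel (\<lambda>z. ennreal (normal_density (c j) \<sigma> z)))"
    then have A: "A j \<in> sets borel" if "j < n" for j using that by auto
    have "emeasure (density (\<Pi>\<^sub>M j\<in>{..<n}. lborel) (\<lambda>y. ennreal (gauss_density n c \<sigma> y))) (Pi\<^sub>E {..<n} A)
        = (\<integral>\<^sup>+y. ennreal (gauss_density n c \<sigma> y) * indicator (Pi\<^sub>E {..<n} A) y \<partial>(\<Pi>\<^sub>M j\<in>{..<n}. lborel))"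
      using A by (intro emeasure_density m sets_PiM_I_finite) auto
    also have "\<dots> = (\<integral>\<^sup>+y. (\<Prod>j<n. ennreal (normal_density (c j) \<sigma> (y j)) * indicator (A j) (y j))
        \<partial>(\<Pi>\<^sub>M j\<in>{..<n}. lborel))"
    proof (rule nn_integral_cong)
      fix y :: "nat \<Rightarrow> real" assume y: "y \<in> space (\<Pi>\<^sub>M j\<in>{..<n}. lborel)"
      have "indicator (Pi\<^sub>E {..<n} A) y = (\<Prod>j<n. indicator (A j) (y j) :: ennreal)"
        using y by (auto simp: indicator_def space_PiM PiE_iff)
      then show "ennreal (gauss_density n c \<sigma> y) * indicator (Pi\<^sub>E {..<n} A) y =
          (\<Prod>j<n. ennreal (normal_density (c j) \<sigma> (y j)) * indicator (A j) (y j))"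
        by (simp add: gauss_density_eq_prod prod_ennreal prod.distrib)
    qed
    also have "\<dots> = (\<Prod>j<n. \<integral>\<^sup>+z. ennreal (normal_density (c j) \<sigma> z) * indicator (A j) z \<partial>lborel)"
      using A by (intro L.product_nn_integral_prod) auto
    also have "\<dots> = (\<Prod>j<n. emeasure (density lborel (\<lambda>z. ennreal (normal_density (c j) \<sigma> z))) (A j))"
      using A by (intro prod.cong refl emeasure_density[symmetric]) auto
    finally show "emeasure (density (\<Pi>\<^sub>M j\<in>{..<n}. lborel) (\<lambda>y. ennreal (gauss_density n c \<sigma> y))) (Pi\<^sub>E {..<n} A)
        = (\<Prod>j<n. emeasure (density lborel (\<lambda>z. ennreal (normal_density (c j) \<sigma> z))) (A j))" .
  qed simp
  then show ?thesis ..
qed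

lemma nn_integral_gauss:
  assumes "0 < \<sigma>" "f \<in> borel_measurable (\<Pi>\<^sub>M j\<in>{..<n}. borel)"
  shows "(\<integral>\<^sup>+y. f y \<partial>gauss n c \<sigma>) =
    (\<integral>\<^sup>+y. ennreal (gauss_density n c \<sigma> y) * f y \<partial>(\<Pi>\<^sub>M j\<in>{..<n}. lborel))"
  using assms gauss_density_measurable
  by (simp add: gauss_eq_density nn_integral_density measurable_cong_sets[OF sets_lborel_PiM refl])

lemma emeasure_normal_translate:
  assumes "A \<in> sets borel"
  shows "emeasure (density lborel (\<lambda>z. ennreal (normal_density 0 \<sigma> z))) {z. c + z \<in> A} =
    emeasure (density lborel (\<lambda>z. ennreal (normal_density c \<sigma> z))) A"
proof -
  have m: "{z. c + z \<in> A} \<in> sets borel"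
    using measurable_sets[of "\<lambda>z. c + z" borel borel A] assms by (simp add: vimage_def)
  have "emeasure (density lborel (\<lambda>z. ennreal (normal_density c \<sigma> z))) A =
      (\<integral>\<^sup>+z. ennreal (normal_density c \<sigma> z) * indicator A z \<partial>lborel)"
    using assms by (intro emeasure_density) auto
  also have "\<dots> = (\<integral>\<^sup>+z. ennreal (normal_density c \<sigma> (c + 1 * z)) * indicator A (c + 1 * z) \<partial>lborel)"
    using assms by (subst nn_integral_real_affine[where c = 1 and t = c]) auto
  also have "\<dots> = (\<integral>\<^sup>+z. ennreal (normal_density 0 \<sigma> z) * indicator {z. c + z \<in> A} z \<partial>lborel)"
    by (intro nn_integral_cong) (simp add: normal_density_def indicator_def)
  also have "\<dots> = emeasure (density lborel (\<lambda>z. ennreal (normal_density 0 \<sigma> z))) {z. c + z \<in> A}"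
    using m by (intro emeasure_density[symmetric]) auto
  finally show ?thesis ..
qed

text \<open>For fixed messages the received vector is the noise translated by the codeword sum; this
  identifies its law, again by comparison on boxes.\<close>

lemma distr_gauss_translate:
  assumes "0 < \<sigma>"
  shows "distr (gauss n (\<lambda>_. 0) \<sigma>) (\<Pi>\<^sub>M j\<in>{..<n}. borel) (\<lambda>Z. \<lambda>j\<in>{..<n}. c j + Z j) = gauss n c \<sigma>"
proof -
  have ps: "prob_space (density lborel (\<lambda>z. ennreal (normal_density (c j) \<sigma> z)))" for c :: "nat \<Rightarrow> real" and j
    using assms by (rule prob_space_normal_density)
  interpret Z: product_sigma_finite "\<lambda>j::nat. density lborel (\<lambda>z. ennreal (normal_density 0 \<sigma> z))"
    by (rule product_sigma_finite.intro) (rule prob_space_imp_sigma_finite[OF ps])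
  interpret G: product_sigma_finite "\<lambda>j. density lborel (\<lambda>z. ennreal (normal_density (c j) \<sigma> z))"
    by (rule product_sigma_finite.intro) (rule prob_space_imp_sigma_finite[OF ps])
  have m: "(\<lambda>Z. \<lambda>j\<in>{..<n}. c j + Z j) \<in> gauss n (\<lambda>_. 0) \<sigma> \<rightarrow>\<^sub>M (\<Pi>\<^sub>M j\<in>{..<n}. borel)"
    by measurable
  show ?thesis
    unfolding gauss_def[of n c]
  proof (rule G.PiM_eqI)
    show "sets (distr (gauss n (\<lambda>_. 0) \<sigma>) (\<Pi>\<^sub>M j\<in>{..<n}. borel) (\<lambda>Z. \<lambda>j\<in>{..<n}. c j + Z j)) =
        sets (\<Pi>\<^sub>M j\<in>{..<n}. density lborel (\<lambda>z. ennreal (normal_density (c j) \<sigma> z)))"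
      by (simp, intro sets_PiM_cong) simp_all
  next
    fix A assume "\<And>j. j \<in> {..<n} \<Longrightarrow> A j \<in> sets (density lborel (\<lambda>z. ennreal (normal_density (c j) \<sigma> z)))"
    then have A: "A j \<in> sets borel" if "j < n" for j using that by auto
    then have A': "{z. c j + z \<in> A j} \<in> sets borel" if "j < n" for j
      using measurable_sets[of "\<lambda>z. c j + z" borel borel "A j"] that by (simp add: vimage_def)
    have "emeasure (distr (gauss n (\<lambda>_. 0) \<sigma>) (\<Pi>\<^sub>M j\<in>{..<n}. borel) (\<lambda>Z. \<lambda>j\<in>{..<n}. c j + Z j)) (Pi\<^sub>E {..<n} A)
        = emeasure (gauss n (\<lambda>_. 0) \<sigma>)
          ((\<lambda>Z. \<lambda>j\<in>{..<n}. c j + Z j) -` Pi\<^sub>E {..<n} A \<inter> space (gauss n (\<lambda>_. 0) \<sigma>))"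
      using A by (intro emeasure_distr m sets_PiM_I_finite) auto
    also have "(\<lambda>Z. \<lambda>j\<in>{..<n}. c j + Z j) -` Pi\<^sub>E {..<n} A \<inter> space (gauss n (\<lambda>_. 0) \<sigma>) =
        (\<Pi>\<^sub>E j\<in>{..<n}. {z. c j + z \<in> A j})"
    proof (rule set_eqI)
      show "Z \<in> (\<lambda>Z. \<lambda>j\<in>{..<n}. c j + Z j) -` Pi\<^sub>E {..<n} A \<inter> space (gauss n (\<lambda>_. 0) \<sigma>) \<longleftrightarrow>
          Z \<in> (\<Pi>\<^sub>E j\<in>{..<n}. {z. c j + z \<in> A j})" for Z
        unfolding space_gauss space_borel_PiM by (simp add: PiE_iff conj_commute)
    qed
    also have "emeasure (gauss n (\<lambda>_. 0) \<sigma>) \<dots> =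
        (\<Prod>j<n. emeasure (density lborel (\<lambda>z. ennreal (normal_density 0 \<sigma> z))) {z. c j + z \<in> A j})"
      unfolding gauss_def using A' by (subst Z.emeasure_PiM) auto
    also have "\<dots> = (\<Prod>j<n. emeasure (density lborel (\<lambda>z. ennreal (normal_density (c j) \<sigma> z))) (A j))"
      using A by (intro prod.cong refl emeasure_normal_translate) auto
    finally show "emeasure (distr (gauss n (\<lambda>_. 0) \<sigma>) (\<Pi>\<^sub>M j\<in>{..<n}. borel) (\<lambda>Z. \<lambda>j\<in>{..<n}. c j + Z j)) (Pi\<^sub>E {..<n} A)
        = (\<Prod>j<n. emeasure (density lborel (\<lambda>z. ennreal (normal_density (c j) \<sigma> z))) (A j))" .
  qed simp
qed

lemma coordinate_measurable:
  fixes n :: nat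
  shows "j < n \<Longrightarrow> (\<lambda>y. y j) \<in> borel_measurable (\<Pi>\<^sub>M j\<in>{..<n}. (borel :: real measure))"
  by (rule measurable_component_singleton) simp

lemma gauss_coordinate_measurable: "j < n \<Longrightarrow> (\<lambda>y. y j) \<in> borel_measurable (gauss n c \<sigma>)"
  unfolding measurable_cong_sets[OF sets_gauss refl] by (rule coordinate_measurable)

lemma distr_gauss_component:
  assumes "0 < \<sigma>" "j < n"
  shows "distr (gauss n c \<sigma>) borel (\<lambda>y. y j) = density lborel (\<lambda>z. ennreal (normal_density (c j) \<sigma> z))"
proof -
  have "distr (gauss n c \<sigma>) (density lborel (\<lambda>z. ennreal (normal_density (c j) \<sigma> z))) (\<lambda>y. y j) =
      density lborel (\<lambda>z. ennreal (normal_density (c j) \<sigma> z))"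
    unfolding gauss_def using assms by (intro distr_PiM_component prob_space_normal_density) auto
  moreover have "distr (gauss n c \<sigma>) (density lborel (\<lambda>z. ennreal (normal_density (c j) \<sigma> z))) (\<lambda>y. y j) =
      distr (gauss n c \<sigma>) borel (\<lambda>y. y j)"
    by (intro distr_cong) simp_all
  ultimately show ?thesis by simp
qed

section \<open>Change of measure and tail bounds\<close>

text \<open>Where the log-likelihood ratio exceeds \<open>\<gamma>\<close>, the density of mean \<open>a\<close> is dominated by a multiple
  of a Gaussian density whose mean is pushed further away from \<open>b\<close>. Being pointwise, the bound avoids
  the distribution of the log-likelihood ratio.\<close>

lemma gauss_density_tilt_bound:
  fixes n :: nat and a b :: "nat \<Rightarrow> real" and \<sigma> s :: real
  assumes "0 \<le> s"
  defines "D \<equiv> (\<Sum>j<n. (a j - b j)\<^sup>2) / (2 * \<sigma>\<^sup>2)"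
  shows "gauss_density n a \<sigma> y \<le> exp \<gamma> * gauss_density n b \<sigma> y +
    exp (s * (1 + s) * D - s * \<gamma>) * gauss_density n (\<lambda>j. a j + s * (a j - b j)) \<sigma> y"
proof -
  define K where "K = (1 / sqrt (2 * pi * \<sigma>\<^sup>2)) ^ n"
  define A where "A = (\<Sum>j<n. (y j - a j)\<^sup>2) / (2 * \<sigma>\<^sup>2)"
  define B where "B = (\<Sum>j<n. (y j - b j)\<^sup>2) / (2 * \<sigma>\<^sup>2)"
  have K: "0 \<le> K" by (simp add: K_def)
  \<comment> \<open>Completing the square: for densities \<open>p_a\<close> and \<open>p_b\<close>,
    the product \<open>p_a ^ (1 + s) * p_b ^ (- s)\<close> is the Gaussian density of mean
    \<open>a + s * (a - b)\<close> times \<open>exp (s * (1 + s) * D)\<close>.\<close>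
  have "(\<Sum>j<n. (y j - (a j + s * (a j - b j)))\<^sup>2) =
      (\<Sum>j<n. (1 + s) * (y j - a j)\<^sup>2 - s * (y j - b j)\<^sup>2 + s * (1 + s) * (a j - b j)\<^sup>2)"
    by (intro sum.cong refl) (simp add: power2_eq_square algebra_simps)
  also have "\<dots> = (1 + s) * (\<Sum>j<n. (y j - a j)\<^sup>2) - s * (\<Sum>j<n. (y j - b j)\<^sup>2)
      + s * (1 + s) * (\<Sum>j<n. (a j - b j)\<^sup>2)"
    by (simp add: sum.distrib sum_subtractf sum_distrib_left)
  finally have T: "(\<Sum>j<n. (y j - (a j + s * (a j - b j)))\<^sup>2) / (2 * \<sigma>\<^sup>2) = (1 + s) * A - s * B + s * (1 + s) * D"
    by (simp only: A_def B_def D_def add_divide_distrib diff_divide_distrib times_divide_eq_right)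
  \<comment> \<open>\<open>B - A\<close> is the log-likelihood ratio of \<open>a\<close> against
    \<open>b\<close>; either it is at most \<open>\<gamma>\<close>, or its excess multiplied by
    \<open>s\<close> pays for the tilt.\<close>
  have "exp (- A) \<le> exp \<gamma> * exp (- B) + exp (s * (1 + s) * D - s * \<gamma>) * exp (- ((1 + s) * A - s * B + s * (1 + s) * D))"
  proof (cases "B - A \<le> \<gamma>")
    case True
    then have "exp (- A) \<le> exp \<gamma> * exp (- B)" by (simp flip: exp_add)
    then show ?thesis by (simp add: add_increasing2)
  next
    case False
    then have "0 \<le> s * (B - A - \<gamma>)" using assms by simp
    then have "exp (- A) \<le> exp (s * (1 + s) * D - s * \<gamma>) * exp (- ((1 + s) * A - s * B + s * (1 + s) * D))"
      by (simp add: algebra_simps flip: exp_add)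
    then show ?thesis by (simp add: add_increasing)
  qed
  then have "K * exp (- A) \<le> K * (exp \<gamma> * exp (- B) + exp (s * (1 + s) * D - s * \<gamma>) *
      exp (- ((1 + s) * A - s * B + s * (1 + s) * D)))"
    using K by (intro mult_left_mono)
  then show ?thesis
    unfolding gauss_density_def K_def[symmetric] minus_divide_left[symmetric] T
    by (simp add: A_def B_def algebra_simps)
qed

text \<open>The pointwise bound integrated over \<open>S\<close>; the pushed-away Gaussian has mass
  at most 1 and leaves only its coefficient. \<open>D\<close> may be any upper bound because that
  coefficient increases with it. \<open>\<gamma>\<close> and \<open>s\<close> stay free for the
  converses to tune.\<close>

lemma gauss_measure_change:
  assumes \<sigma>: "0 < \<sigma>" and s: "0 \<le> s" and S: "S \<in> sets (\<Pi>\<^sub>M j\<in>{..<n}. borel)"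
    and D: "(\<Sum>j<n. (a j - b j)\<^sup>2) / (2 * \<sigma>\<^sup>2) \<le> D"
  shows "measure (gauss n a \<sigma>) S \<le>
    exp \<gamma> * measure (gauss n b \<sigma>) S + exp (s * (1 + s) * D - s * \<gamma>)"
proof -
  interpret a: prob_space "gauss n a \<sigma>" by (rule prob_space_gauss[OF \<sigma>])
  interpret b: prob_space "gauss n b \<sigma>" by (rule prob_space_gauss[OF \<sigma>])
  define c where "c = (\<lambda>j. a j + s * (a j - b j))"
  define u where "u = exp (s * (1 + s) * D - s * \<gamma>)"
  interpret c: prob_space "gauss n c \<sigma>" by (rule prob_space_gauss[OF \<sigma>])
  have em: "emeasure (gauss n x \<sigma>) S =
      (\<integral>\<^sup>+y. ennreal (gauss_density n x \<sigma> y) * indicator S y \<partial>(\<Pi>\<^sub>M j\<in>{..<n}. lborel))" for x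
    using nn_integral_gauss[OF \<sigma>, of "indicator S" n x] S by simp
  have S': "S \<in> sets (\<Pi>\<^sub>M j\<in>{..<n}. lborel)"
    using S sets_lborel_PiM by simp
  have m: "gauss_density n x \<sigma> \<in> borel_measurable (\<Pi>\<^sub>M j\<in>{..<n}. lborel)" for x
    using gauss_density_measurable by (simp add: measurable_cong_sets[OF sets_lborel_PiM refl])
  have pt: "gauss_density n a \<sigma> y \<le> exp \<gamma> * gauss_density n b \<sigma> y + u * gauss_density n c \<sigma> y" for y
  proof -
    have "exp (s * (1 + s) * ((\<Sum>j<n. (a j - b j)\<^sup>2) / (2 * \<sigma>\<^sup>2)) - s * \<gamma>) \<le> u"
      unfolding u_def using s D by (intro exp_mono diff_right_mono mult_left_mono) auto
    then have "exp (s * (1 + s) * ((\<Sum>j<n. (a j - b j)\<^sup>2) / (2 * \<sigma>\<^sup>2)) - s * \<gamma>) * gauss_density n c \<sigma> y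
        \<le> u * gauss_density n c \<sigma> y"
      by (intro mult_right_mono) auto
    then show ?thesis
      using gauss_density_tilt_bound[OF s, of n a \<sigma> y \<gamma> b] unfolding c_def by linarith
  qed
  have "emeasure (gauss n a \<sigma>) S \<le> (\<integral>\<^sup>+y. ennreal (exp \<gamma>) * (ennreal (gauss_density n b \<sigma> y) * indicator S y) +
      ennreal u * (ennreal (gauss_density n c \<sigma> y) * indicator S y) \<partial>(\<Pi>\<^sub>M j\<in>{..<n}. lborel))"
    unfolding em
  proof (intro nn_integral_mono)
    fix y
    show "ennreal (gauss_density n a \<sigma> y) * indicator S y \<le>
        ennreal (exp \<gamma>) * (ennreal (gauss_density n b \<sigma> y) * indicator S y) +
        ennreal u * (ennreal (gauss_density n c \<sigma> y) * indicator S y)"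
      using ennreal_leI[OF pt[of y]]
      by (auto simp: indicator_def ennreal_plus[symmetric] ennreal_mult[symmetric] u_def
          simp del: ennreal_plus)
  qed
  also have "\<dots> = ennreal (exp \<gamma>) * emeasure (gauss n b \<sigma>) S + ennreal u * emeasure (gauss n c \<sigma>) S"
    unfolding em using m S' by (subst nn_integral_add) (auto simp: nn_integral_cmult)
  also have "\<dots> \<le> ennreal (exp \<gamma>) * emeasure (gauss n b \<sigma>) S + ennreal u * 1"
    by (intro add_left_mono mult_left_mono c.measure_le_1) auto
  also have "\<dots> = ennreal (exp \<gamma> * measure (gauss n b \<sigma>) S + u)"
    by (simp add: b.emeasure_eq_measure ennreal_mult u_def)
  finally show ?thesis
    by (simp add: a.emeasure_eq_measure u_def del: ennreal_plus)
qed

text \<open>Chernoff bound, again by comparing densities: on the event the density of mean \<open>c\<close> is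
  dominated by a multiple of the density centred at the threshold.\<close>

lemma normal_upper_tail:
  assumes \<sigma>: "0 < \<sigma>" and t: "0 \<le> t"
  shows "measure (density lborel (\<lambda>z. ennreal (normal_density c \<sigma> z))) {c + t..} \<le> exp (- t\<^sup>2 / (2 * \<sigma>\<^sup>2))"
proof -
  interpret c: prob_space "density lborel (\<lambda>z. ennreal (normal_density c \<sigma> z))"
    by (rule prob_space_normal_density[OF \<sigma>])
  interpret d: prob_space "density lborel (\<lambda>z. ennreal (normal_density (c + t) \<sigma> z))"
    by (rule prob_space_normal_density[OF \<sigma>])
  have pt: "normal_density c \<sigma> z \<le> exp (- t\<^sup>2 / (2 * \<sigma>\<^sup>2)) * normal_density (c + t) \<sigma> z" if "c + t \<le> z" for z
  proof -
    have "0 \<le> t * (z - (c + t))" using that t by simp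
    then have "t\<^sup>2 + (z - (c + t))\<^sup>2 \<le> (z - c)\<^sup>2" by (simp add: power2_eq_square algebra_simps)
    then have "(t\<^sup>2 + (z - (c + t))\<^sup>2) / (2 * \<sigma>\<^sup>2) \<le> (z - c)\<^sup>2 / (2 * \<sigma>\<^sup>2)"
      by (intro divide_right_mono) auto
    then have "exp (- (z - c)\<^sup>2 / (2 * \<sigma>\<^sup>2)) \<le> exp (- t\<^sup>2 / (2 * \<sigma>\<^sup>2)) * exp (- (z - (c + t))\<^sup>2 / (2 * \<sigma>\<^sup>2))"
      by (simp add: add_divide_distrib flip: exp_add)
    then show ?thesis
      unfolding normal_density_def by (simp add: divide_right_mono)
  qed
  have "emeasure (density lborel (\<lambda>z. ennreal (normal_density c \<sigma> z))) {c + t..} =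
      (\<integral>\<^sup>+z. ennreal (normal_density c \<sigma> z) * indicator {c + t..} z \<partial>lborel)"
    by (intro emeasure_density) auto
  also have "\<dots> \<le> (\<integral>\<^sup>+z. ennreal (exp (- t\<^sup>2 / (2 * \<sigma>\<^sup>2))) *
      (ennreal (normal_density (c + t) \<sigma> z) * indicator UNIV z) \<partial>lborel)"
    using pt by (intro nn_integral_mono) (auto simp: indicator_def ennreal_mult[symmetric])
  also have "\<dots> = ennreal (exp (- t\<^sup>2 / (2 * \<sigma>\<^sup>2))) *
      emeasure (density lborel (\<lambda>z. ennreal (normal_density (c + t) \<sigma> z))) UNIV"
    by (subst nn_integral_cmult) (auto simp: emeasure_density)
  also have "\<dots> = ennreal (exp (- t\<^sup>2 / (2 * \<sigma>\<^sup>2)))"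
    using d.emeasure_space_1 by simp
  finally show ?thesis by (simp add: c.emeasure_eq_measure)
qed

text \<open>The reflection of \<open>z\<close> to \<open>- z\<close> exchanges the two
  tails.\<close>

lemma normal_lower_tail:
  assumes \<sigma>: "0 < \<sigma>" and t: "0 \<le> t"
  shows "measure (density lborel (\<lambda>z. ennreal (normal_density c \<sigma> z))) {..c - t} \<le> exp (- t\<^sup>2 / (2 * \<sigma>\<^sup>2))"
proof -
  have "emeasure (density lborel (\<lambda>z. ennreal (normal_density c \<sigma> z))) {..c - t} =
      (\<integral>\<^sup>+z. ennreal (normal_density c \<sigma> z) * indicator {..c - t} z \<partial>lborel)"
    by (intro emeasure_density) auto
  also have "\<dots> = (\<integral>\<^sup>+z. ennreal (normal_density c \<sigma> (0 + -1 * z)) * indicator {..c - t} (0 + -1 * z) \<partial>lborel)"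
    by (subst nn_integral_real_affine[where c = "-1" and t = 0]) auto
  also have "\<dots> = (\<integral>\<^sup>+z. ennreal (normal_density (- c) \<sigma> z) * indicator {- c + t..} z \<partial>lborel)"
    by (intro nn_integral_cong) (auto simp: normal_density_def indicator_def power2_commute add.commute
        intro!: arg_cong2[where f = "(*)"] arg_cong[where f = ennreal])
  also have "\<dots> = emeasure (density lborel (\<lambda>z. ennreal (normal_density (- c) \<sigma> z))) {- c + t..}"
    by (intro emeasure_density[symmetric]) auto
  finally show ?thesis
    using normal_upper_tail[OF assms, of "- c"] by (simp add: measure_def)
qed

lemma gauss_upper_tail:
  assumes "0 < \<sigma>" "j < n" "c j \<le> t"
  shows "measure (gauss n c \<sigma>) {y \<in> space (gauss n c \<sigma>). t \<le> y j} \<le> exp (- (t - c j)\<^sup>2 / (2 * \<sigma>\<^sup>2))"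
proof -
  have "measure (distr (gauss n c \<sigma>) borel (\<lambda>y. y j)) {t..} =
      measure (gauss n c \<sigma>) ((\<lambda>y. y j) -` {t..} \<inter> space (gauss n c \<sigma>))"
    using assms by (intro measure_distr) auto
  also have "(\<lambda>y. y j) -` {t..} \<inter> space (gauss n c \<sigma>) = {y \<in> space (gauss n c \<sigma>). t \<le> y j}" by auto
  finally show ?thesis
    using normal_upper_tail[of \<sigma> "t - c j" "c j"] assms by (simp add: distr_gauss_component)
qed

lemma gauss_lower_tail:
  assumes "0 < \<sigma>" "j < n" "t \<le> c j"
  shows "measure (gauss n c \<sigma>) {y \<in> space (gauss n c \<sigma>). y j \<le> t} \<le> exp (- (c j - t)\<^sup>2 / (2 * \<sigma>\<^sup>2))"
proof -
  have "measure (distr (gauss n c \<sigma>) borel (\<lambda>y. y j)) {..t} =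
      measure (gauss n c \<sigma>) ((\<lambda>y. y j) -` {..t} \<inter> space (gauss n c \<sigma>))"
    using assms by (intro measure_distr) auto
  also have "(\<lambda>y. y j) -` {..t} \<inter> space (gauss n c \<sigma>) = {y \<in> space (gauss n c \<sigma>). y j \<le> t}" by auto
  finally show ?thesis
    using normal_lower_tail[of \<sigma> "c j - t" "c j"] assms by (simp add: distr_gauss_component)
qed

section \<open>Single-user converses\<close>

text \<open>Each codeword is compared with its cyclic successor, so that every error probability occurs once
  on either side of the comparison.\<close>

lemma two_codewords_error_lower_bound:
  fixes n M :: nat and h :: "(nat \<Rightarrow> real) \<Rightarrow> nat"
  assumes \<sigma>: "0 < \<sigma>" and M: "2 \<le> M"
    and h: "\<And>w. {y \<in> space (\<Pi>\<^sub>M j\<in>{..<n}. borel). h y \<noteq> (w::nat)} \<in> sets (\<Pi>\<^sub>M j\<in>{..<n}. borel)"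
    and D: "\<And>v w. v \<in> {1..M} \<Longrightarrow> w \<in> {1..M} \<Longrightarrow> (\<Sum>j<n. (c v j - c w j)\<^sup>2) / (2 * \<sigma>\<^sup>2) \<le> D"
  defines "\<eta> \<equiv> (\<Sum>w=1..M. measure (gauss n (c w) \<sigma>) {y \<in> space (\<Pi>\<^sub>M j\<in>{..<n}. borel). h y \<noteq> w}) / real M"
  shows "(3/4) / (1 + exp (2 * D + ln 4)) \<le> \<eta>"
proof -
  define N :: "(nat \<Rightarrow> real) measure" where "N = (\<Pi>\<^sub>M j\<in>{..<n}. borel)"
  define e where "e w = measure (gauss n (c w) \<sigma>) {y \<in> space N. h y \<noteq> w}" for w
  define k where "k = exp (2 * D + ln 4)"
  define f where "f w = (if w = M then 1 else w + 1)" for w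
  have ps: "prob_space (gauss n (c w) \<sigma>)" for w by (rule prob_space_gauss[OF \<sigma>])
  have spN: "space (gauss n (c w) \<sigma>) = space N" for w by (simp add: space_gauss N_def)
  have compl: "measure (gauss n (c w) \<sigma>) {y \<in> space N. h y = v} =
      1 - measure (gauss n (c w) \<sigma>) {y \<in> space N. h y \<noteq> v}" for w v
  proof -
    have "{y \<in> space N. h y = v} = space (gauss n (c w) \<sigma>) - {y \<in> space N. h y \<noteq> v}"
      by (auto simp: spN)
    then show ?thesis
      using prob_space.prob_compl[OF ps[of w], of "{y \<in> space N. h y \<noteq> v}"] h[of v]
      by (simp add: N_def)
  qed
  have step: "3/4 \<le> k * e (f w) + e w" if w: "w \<in> {1..M}" for w
  proof -
    have fw: "f w \<in> {1..M}" "f w \<noteq> w" using w M by (auto simp: f_def)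
    have eq: "{y \<in> space N. h y = w} = space N - {y \<in> space N. h y \<noteq> w}" by auto
    have S: "{y \<in> space N. h y = w} \<in> sets N"
      unfolding eq using h[of w] by (auto simp: N_def)
    \<comment> \<open>With \<open>s = 1\<close> and \<open>\<gamma> = 2 * D + ln 4\<close> the
      additive term is \<open>exp (2 * D - \<gamma>) = 1/4\<close>, which is where the constant 3/4
      comes from.\<close>
    have "1 - e w \<le> k * measure (gauss n (c (f w)) \<sigma>) {y \<in> space N. h y = w}
        + exp (1 * (1 + 1) * D - 1 * (2 * D + ln 4))"
      using gauss_measure_change[OF \<sigma>, of 1 _ n "c w" "c (f w)" D "2 * D + ln 4"] S D[OF w fw(1)]
      unfolding compl[of w w, folded e_def, symmetric] k_def N_def by simp
    also have "exp (1 * (1 + 1) * D - 1 * (2 * D + ln 4)) = (1/4 :: real)"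
      by (simp add: exp_minus inverse_eq_divide)
    \<comment> \<open>Deciding for \<open>w\<close> is an error when \<open>f w\<close> was
      sent.\<close>
    also have "measure (gauss n (c (f w)) \<sigma>) {y \<in> space N. h y = w} \<le> e (f w)"
      unfolding e_def using fw h[of "f w"] ps[of "f w"]
      by (intro finite_measure.finite_measure_mono[OF prob_space.finite_measure]) (auto simp: N_def)
    finally show ?thesis by (simp add: k_def)
  qed
  have inj: "inj_on f {1..M}" by (auto simp: inj_on_def f_def split: if_splits)
  have "f ` {1..M} = {1..M}"
    using M by (intro endo_inj_surj inj) (auto simp: f_def)
  then have reindex: "(\<Sum>w=1..M. e (f w)) = (\<Sum>w=1..M. e w)"
    using sum.reindex[OF inj, of e] by simp
  have "real M * (3/4) \<le> (\<Sum>w=1..M. k * e (f w) + e w)"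
    using sum_mono[of "{1..M}" "\<lambda>_. 3/4" "\<lambda>w. k * e (f w) + e w"] step by simp
  also have "\<dots> = (1 + k) * (\<Sum>w=1..M. e w)"
    by (simp add: sum.distrib sum_distrib_left[symmetric] reindex[unfolded One_nat_def] algebra_simps)
  finally have "3/4 \<le> (1 + k) * ((\<Sum>w=1..M. e w) / real M)"
    using M by (simp add: field_simps)
  moreover have "0 < 1 + k" by (simp add: k_def add_pos_pos)
  ultimately show ?thesis
    unfolding \<eta>_def e_def N_def k_def by (subst pos_divide_le_eq) (simp_all only: mult.commute)
qed

text \<open>All codewords are compared with the common reference point \<open>b\<close>, under which the disjoint decoding
  regions have total probability at most 1.\<close>

lemma many_codewords_error_lower_bound:
  fixes n M :: nat and h :: "(nat \<Rightarrow> real) \<Rightarrow> nat"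
  assumes \<sigma>: "0 < \<sigma>" and M: "1 \<le> M" and s: "0 \<le> s"
    and h: "\<And>w. {y \<in> space (\<Pi>\<^sub>M j\<in>{..<n}. borel). h y \<noteq> (w::nat)} \<in> sets (\<Pi>\<^sub>M j\<in>{..<n}. borel)"
    and D: "\<And>w. w \<in> {1..M} \<Longrightarrow> (\<Sum>j<n. (c w j - b j)\<^sup>2) / (2 * \<sigma>\<^sup>2) \<le> D"
  defines "\<eta> \<equiv> (\<Sum>w=1..M. measure (gauss n (c w) \<sigma>) {y \<in> space (\<Pi>\<^sub>M j\<in>{..<n}. borel). h y \<noteq> w}) / real M"
  shows "1 - exp \<gamma> / real M - exp (s * (1 + s) * D - s * \<gamma>) \<le> \<eta>"
proof -
  define N :: "(nat \<Rightarrow> real) measure" where "N = (\<Pi>\<^sub>M j\<in>{..<n}. borel)"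
  define e where "e w = measure (gauss n (c w) \<sigma>) {y \<in> space N. h y \<noteq> w}" for w
  define u where "u = exp (s * (1 + s) * D - s * \<gamma>)"
  define A where "A w = {y \<in> space N. h y = w}" for w
  interpret b: prob_space "gauss n b \<sigma>" by (rule prob_space_gauss[OF \<sigma>])
  have spN: "space (gauss n x \<sigma>) = space N" for x by (simp add: space_gauss N_def)
  have A: "A w \<in> sets N" for w
  proof -
    have "A w = space N - {y \<in> space N. h y \<noteq> w}" by (auto simp: A_def)
    then show ?thesis using h[of w] by (auto simp: N_def)
  qed
  have step: "1 - e w \<le> exp \<gamma> * b.prob (A w) + u" if w: "w \<in> {1..M}" for w
  proof -
    have "{y \<in> space N. h y \<noteq> w} = space (gauss n (c w) \<sigma>) - A w"
      by (auto simp: spN A_def)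
    then have "1 - e w = measure (gauss n (c w) \<sigma>) (A w)"
      using prob_space.prob_compl[OF prob_space_gauss[OF \<sigma>], of "A w" n "c w"] A[of w]
      by (simp add: e_def N_def)
    also have "\<dots> \<le> exp \<gamma> * b.prob (A w) + u"
      unfolding u_def using gauss_measure_change[OF \<sigma> s _ D[OF w]] A by (simp add: N_def)
    finally show ?thesis .
  qed
  have "(\<Sum>w=1..M. b.prob (A w)) = b.prob (\<Union>w\<in>{1..M}. A w)"
    using A by (intro b.finite_measure_finite_Union[symmetric])
      (auto simp: disjoint_family_on_def A_def N_def)
  then have sum1: "(\<Sum>w=1..M. b.prob (A w)) \<le> 1" by simp
  have "real M - (\<Sum>w=1..M. e w) = (\<Sum>w=1..M. 1 - e w)"
    by (simp add: sum_subtractf)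
  also have "\<dots> \<le> (\<Sum>w=1..M. exp \<gamma> * b.prob (A w) + u)"
    by (intro sum_mono step)
  also have "\<dots> = exp \<gamma> * (\<Sum>w=1..M. b.prob (A w)) + M * u"
    by (simp add: sum.distrib sum_distrib_left)
  also have "\<dots> \<le> exp \<gamma> * 1 + M * u"
    using sum1 by (intro add_right_mono mult_left_mono) auto
  finally have "real M - exp \<gamma> - M * u \<le> (\<Sum>w=1..M. e w)" by simp
  moreover have "(1 - exp \<gamma> / real M - u) * real M = real M - exp \<gamma> - M * u"
    using M by (simp add: left_diff_distrib)
  ultimately have "(1 - exp \<gamma> / real M - u) * real M \<le> (\<Sum>w=1..M. e w)" by simp
  then show ?thesis
    unfolding \<eta>_def e_def[folded N_def, symmetric] N_def[symmetric] u_def[symmetric]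
    using M by (simp add: pos_le_divide_eq)
qed

section \<open>The random access channel\<close>

abbreviation codeword_sum ::
    "nat \<Rightarrow> (nat \<Rightarrow> nat \<Rightarrow> nat \<Rightarrow> real) \<Rightarrow> (nat \<Rightarrow> nat) \<Rightarrow> nat \<Rightarrow> real" where
  "codeword_sum l x W j \<equiv> (\<Sum>i<l. x i (W i) j)"

lemma noise_eq_gauss: "noise N0 n = gauss n (\<lambda>_. 0) (sqrt (N0 / 2))"
  by (simp add: noise_def gauss_def)

lemma set_message_pmf_subset:
  assumes "0 \<le> \<alpha>" "\<alpha> \<le> 1" "1 \<le> M"
  shows "set_pmf (message_pmf \<alpha> M) \<subseteq> {0..M}"
  using assms by (auto simp: set_pmf_eq pmf_message_pmf split: if_splits)

lemma set_messages_pmf: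
  assumes "0 \<le> \<alpha>" "\<alpha> \<le> 1" "1 \<le> M" "W \<in> set_pmf (messages_pmf \<alpha> M l)"
  shows "W i \<le> M"
proof (cases "i < l")
  case True
  then have "W i \<in> set_pmf (message_pmf \<alpha> M)"
    using assms(4) by (auto simp: messages_pmf_def set_Pi_pmf PiE_dflt_def)
  then show ?thesis using set_message_pmf_subset[OF assms(1-3)] by auto
next
  case False
  then show ?thesis using assms(4) by (auto simp: messages_pmf_def set_Pi_pmf PiE_dflt_def)
qed

lemma finite_set_messages_pmf:
  assumes "0 \<le> \<alpha>" "\<alpha> \<le> 1" "1 \<le> M"
  shows "finite (set_pmf (messages_pmf \<alpha> M l))"
  unfolding messages_pmf_def set_Pi_pmf[OF finite_lessThan]
  by (intro finite_PiE_dflt) (auto intro: finite_subset[OF set_message_pmf_subset[OF assms]])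

lemma decoder_error_measurable:
  assumes g: "g \<in> (\<Pi>\<^sub>M j\<in>{..<n}. borel) \<rightarrow>\<^sub>M (\<Pi>\<^sub>M i\<in>{..<l}. count_space {0..M::nat})" and "i < l"
  shows "{y \<in> space (\<Pi>\<^sub>M j\<in>{..<n}. borel). g y i \<noteq> w} \<in> sets (\<Pi>\<^sub>M j\<in>{..<n}. borel)"
proof -
  have "(\<lambda>v. v i) \<in> (\<Pi>\<^sub>M i\<in>{..<l}. count_space {0..M}) \<rightarrow>\<^sub>M count_space {0..M}"
    using assms by (intro measurable_component_singleton) auto
  from measurable_compose[OF g this]
  have "(\<lambda>y. g y i) \<in> (\<Pi>\<^sub>M j\<in>{..<n}. borel) \<rightarrow>\<^sub>M count_space UNIV"
    by (rule measurable_compose) simp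
  from measurable_sets[OF this, of "- {w}"] show ?thesis
    by (simp add: vimage_def Int_def conj_commute)
qed

text \<open>Disintegration of the channel space along the messages: the section of the error event
  at \<open>W\<close> is the preimage of a decoder error set under a translation of the noise. From
  here on only the measures \<open>gauss\<close> matter.\<close>

lemma user_error_prob_eq:
  assumes code: "APE_code N0 \<alpha> l n M E \<epsilon> x g" and "0 < N0" "i < l"
  shows "user_error_prob N0 \<alpha> l n M x g i = (\<integral>W. measure (gauss n (codeword_sum l x W) (sqrt (N0 / 2)))
    {y \<in> space (\<Pi>\<^sub>M j\<in>{..<n}. borel). g y i \<noteq> W i} \<partial>messages_pmf \<alpha> M l)"
proof -
  define B :: "(nat \<Rightarrow> real) measure" where "B = (\<Pi>\<^sub>M j\<in>{..<n}. borel)"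
  define P where "P = messages_pmf \<alpha> M l"
  define \<sigma> where "\<sigma> = sqrt (N0 / 2)"
  have \<sigma>: "0 < \<sigma>" using assms by (simp add: \<sigma>_def)
  interpret Z: prob_space "noise N0 n" unfolding noise_eq_gauss using \<sigma> by (simp add: prob_space_gauss \<sigma>_def)
  have chan: "channel_space N0 \<alpha> l n M = measure_pmf P \<Otimes>\<^sub>M noise N0 n"
    by (simp add: channel_space_def P_def)
  interpret C: pair_prob_space "measure_pmf P" "noise N0 n" ..
  define S where "S = {(W, Z) \<in> space (channel_space N0 \<alpha> l n M). g (received n l x W Z) i \<noteq> W i}"
  have S: "S \<in> sets (measure_pmf P \<Otimes>\<^sub>M noise N0 n)"
    using error_event_measurable[OF code \<open>i < l\<close>] unfolding S_def chan .
  have fib: "emeasure (noise N0 n) (Pair W -` S) =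
      ennreal (measure (gauss n (codeword_sum l x W) \<sigma>) {y \<in> space B. g y i \<noteq> W i})" for W
  proof -
    interpret G: prob_space "gauss n (codeword_sum l x W) \<sigma>" by (rule prob_space_gauss[OF \<sigma>])
    have m: "(\<lambda>Z. \<lambda>j\<in>{..<n}. codeword_sum l x W j + Z j) \<in> noise N0 n \<rightarrow>\<^sub>M B"
      unfolding noise_eq_gauss B_def by measurable
    have E: "{y \<in> space B. g y i \<noteq> W i} \<in> sets B"
      unfolding B_def using code \<open>i < l\<close> by (intro decoder_error_measurable[of g n l M]) (auto simp: APE_code_def)
    have "Pair W -` S = (\<lambda>Z. \<lambda>j\<in>{..<n}. codeword_sum l x W j + Z j) -` {y \<in> space B. g y i \<noteq> W i} \<inter> space (noise N0 n)"
      using measurable_space[OF m]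
      by (auto simp: S_def chan space_pair_measure received_def)
    then have "emeasure (noise N0 n) (Pair W -` S) =
        emeasure (distr (noise N0 n) B (\<lambda>Z. \<lambda>j\<in>{..<n}. codeword_sum l x W j + Z j)) {y \<in> space B. g y i \<noteq> W i}"
      by (simp add: emeasure_distr[OF m E])
    also have "distr (noise N0 n) B (\<lambda>Z. \<lambda>j\<in>{..<n}. codeword_sum l x W j + Z j) = gauss n (codeword_sum l x W) \<sigma>"
      unfolding noise_eq_gauss B_def \<sigma>_def[symmetric] by (rule distr_gauss_translate[OF \<sigma>])
    finally show ?thesis by (simp add: G.emeasure_eq_measure)
  qed
  have "ennreal (user_error_prob N0 \<alpha> l n M x g i) = emeasure (measure_pmf P \<Otimes>\<^sub>M noise N0 n) S"
    unfolding user_error_prob_def C.emeasure_eq_measure S_def chan by (simp add: case_prod_unfold)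
  also have "\<dots> = (\<integral>\<^sup>+W. ennreal (measure (gauss n (codeword_sum l x W) \<sigma>) {y \<in> space B. g y i \<noteq> W i}) \<partial>P)"
    by (subst Z.emeasure_pair_measure_alt[OF S]) (simp add: fib)
  also have "\<dots> = ennreal (\<integral>W. measure (gauss n (codeword_sum l x W) \<sigma>) {y \<in> space B. g y i \<noteq> W i} \<partial>P)"
    by (intro nn_integral_eq_integral measure_pmf.integrable_const_bound[where B = 1])
       (auto intro!: AE_pmfI prob_space.prob_le_1 prob_space_gauss \<sigma>)
  finally show ?thesis
    unfolding B_def P_def \<sigma>_def by (subst (asm) ennreal_inj) (auto simp: user_error_prob_def intro!: integral_nonneg_AE)
qed

text \<open>Given the messages of the other users, user \<open>i\<close> has a single-user code shifted by \<open>b\<close>, the sum of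
  their codewords.\<close>

lemma user_error_prob_ge:
  assumes code: "APE_code N0 \<alpha> l n M E \<epsilon> x g" and N0: "0 < N0" and i: "i < l"
    and \<alpha>: "0 < \<alpha>" "\<alpha> \<le> 1" and \<eta>: "0 \<le> \<eta>"
    and le: "\<And>b. \<eta> \<le> (\<Sum>w=1..M. measure (gauss n (\<lambda>j. b j + x i w j) (sqrt (N0 / 2)))
      {y \<in> space (\<Pi>\<^sub>M j\<in>{..<n}. borel). g y i \<noteq> w}) / real M"
  shows "\<alpha> * \<eta> \<le> user_error_prob N0 \<alpha> l n M x g i"
proof -
  define \<sigma> where "\<sigma> = sqrt (N0 / 2)"
  have \<sigma>: "0 < \<sigma>" using N0 by (simp add: \<sigma>_def)
  have M: "1 \<le> M" using code by (simp add: APE_code_def)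
  define e where "e W = measure (gauss n (codeword_sum l x W) \<sigma>)
    {y \<in> space (\<Pi>\<^sub>M j\<in>{..<n}. borel). g y i \<noteq> W i}" for W
  define A where "A = {..<l} - {i}"
  define Q where "Q = Pi_pmf A 0 (\<lambda>_. message_pmf \<alpha> M)"
  have ins: "{..<l} = insert i A" "finite A" "i \<notin> A" using i by (auto simp: A_def)
  have e01: "0 \<le> e W" "e W \<le> 1" for W
    unfolding e_def by (auto intro!: prob_space.prob_le_1 prob_space_gauss \<sigma>)
  have inner: "ennreal (\<alpha> * \<eta>) \<le> (\<integral>\<^sup>+w. ennreal (e (f(i := w))) \<partial>message_pmf \<alpha> M)" for f
  proof -
    have cw: "codeword_sum l x (f(i := w)) = (\<lambda>j. (\<Sum>k\<in>A. x k (f k) j) + x i w j)" for w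
    proof
      fix j
      have "codeword_sum l x (f(i := w)) j = (\<Sum>k\<in>A. x k ((f(i := w)) k) j) + x i w j"
        unfolding ins(1) using ins(2,3) by simp
      also have "(\<Sum>k\<in>A. x k ((f(i := w)) k) j) = (\<Sum>k\<in>A. x k (f k) j)"
        using ins(3) by (intro sum.cong refl) (metis fun_upd_other)
      finally show "codeword_sum l x (f(i := w)) j = (\<Sum>k\<in>A. x k (f k) j) + x i w j" .
    qed
    have ecw: "e (f(i := w)) = measure (gauss n (\<lambda>j. (\<Sum>k\<in>A. x k (f k) j) + x i w j) (sqrt (N0 / 2)))
        {y \<in> space (\<Pi>\<^sub>M j\<in>{..<n}. borel). g y i \<noteq> w}" for w
      unfolding e_def cw \<sigma>_def by simp
    have "\<alpha> * \<eta> \<le> \<alpha> * ((\<Sum>w=1..M. e (f(i := w))) / real M)"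
      unfolding ecw using le[of "\<lambda>j. \<Sum>k\<in>A. x k (f k) j"] \<alpha> by (intro mult_left_mono) auto
    also have "\<dots> = (\<Sum>w=1..M. e (f(i := w)) * (\<alpha> / real M))"
      by (simp add: sum_distrib_left sum_divide_distrib mult.commute)
    also have "\<dots> = (\<Sum>w=1..M. e (f(i := w)) * pmf (message_pmf \<alpha> M) w)"
      using \<alpha> M by (intro sum.cong refl) (auto simp: pmf_message_pmf)
    \<comment> \<open>The right-hand side gains the nonnegative term \<open>w = 0\<close>, the error
      of an inactive user.\<close>
    also have "\<dots> \<le> (\<Sum>w\<in>{0..M}. e (f(i := w)) * pmf (message_pmf \<alpha> M) w)"
      using e01 by (intro sum_mono2) auto
    finally have "ennreal (\<alpha> * \<eta>) \<le> ennreal \<dots>" by (rule ennreal_leI)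
    also have "\<dots> = (\<Sum>w\<in>{0..M}. ennreal (e (f(i := w))) * pmf (message_pmf \<alpha> M) w)"
      using e01 by (subst sum_ennreal[symmetric]) (auto simp: ennreal_mult)
    also have "\<dots> = (\<integral>\<^sup>+w. ennreal (e (f(i := w))) \<partial>message_pmf \<alpha> M)"
      using set_message_pmf_subset[of \<alpha> M] \<alpha> M
      by (intro nn_integral_measure_pmf_support[symmetric]) auto
    finally show ?thesis .
  qed
  have "ennreal (\<alpha> * \<eta>) \<le> (\<integral>\<^sup>+f. ennreal (\<alpha> * \<eta>) \<partial>Q)"
    by (simp add: measure_pmf.emeasure_space_1[simplified])
  also have "\<dots> \<le> (\<integral>\<^sup>+f. \<integral>\<^sup>+w. ennreal (e (f(i := w))) \<partial>message_pmf \<alpha> M \<partial>Q)"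
    by (intro nn_integral_mono inner)
  \<comment> \<open>The message of user \<open>i\<close> is independent of the others, so
    \<open>W\<close> can be drawn as \<open>f\<close> followed by \<open>w\<close>.\<close>
  also have "\<dots> = (\<integral>\<^sup>+W. ennreal (e W) \<partial>messages_pmf \<alpha> M l)"
    unfolding messages_pmf_def ins(1) Pi_pmf_insert[OF ins(2,3)]
    by (subst pair_commute_pmf) (simp add: Q_def nn_integral_pair_pmf' case_prod_unfold)
  also have "\<dots> = ennreal (\<integral>W. e W \<partial>messages_pmf \<alpha> M l)"
    using e01 by (intro nn_integral_eq_integral measure_pmf.integrable_const_bound[where B = 1])
      (auto intro!: AE_pmfI)
  also have "(\<integral>W. e W \<partial>messages_pmf \<alpha> M l) = user_error_prob N0 \<alpha> l n M x g i"
    unfolding user_error_prob_eq[OF code N0 i] e_def \<sigma>_def ..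
  finally show ?thesis
    by (subst (asm) ennreal_le_iff) (auto simp: user_error_prob_def)
qed

section \<open>Single-user error bounds for codes of the channel\<close>

lemma avg_error_prob_ge:
  assumes "\<And>i. i < l \<Longrightarrow> \<kappa> \<le> user_error_prob N0 \<alpha> l n M x g i" "1 \<le> l"
  shows "\<kappa> \<le> avg_error_prob N0 \<alpha> l n M x g"
  using sum_bounded_below[of "{..<l}" \<kappa> "user_error_prob N0 \<alpha> l n M x g"] assms
  by (simp add: avg_error_prob_def field_simps)

text \<open>Codewords of energy at most \<open>E\<close> have squared distance at most
  \<open>4 * E\<close>, so with \<open>2 * \<sigma>\<^sup>2 = N0\<close> the comparison applies with
  \<open>D = 4 * E / N0\<close>. The shift \<open>b\<close> cancels in differences, which makes the
  bound uniform in the messages of the other users.\<close>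

lemma APE_code_low_energy_error:
  assumes code: "APE_code N0 \<alpha> l n M E \<epsilon> x g" and N0: "0 < N0" and l: "1 \<le> l"
    and \<alpha>: "0 < \<alpha>" "\<alpha> \<le> 1" and M: "2 \<le> M"
  shows "\<alpha> * ((3/4) / (1 + exp (8 * E / N0 + ln 4))) \<le> avg_error_prob N0 \<alpha> l n M x g"
proof (rule avg_error_prob_ge[OF user_error_prob_ge[OF code N0 _ \<alpha>] l])
  fix i b assume i: "i < l"
  have g: "g \<in> (\<Pi>\<^sub>M j\<in>{..<n}. borel) \<rightarrow>\<^sub>M (\<Pi>\<^sub>M i\<in>{..<l}. count_space {0..M})"
    using code by (simp add: APE_code_def)
  have energy: "(\<Sum>j<n. (x i w j)\<^sup>2) \<le> E" if "w \<le> M" for w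
    using code i that unfolding APE_code_def by blast
  have dist: "(\<Sum>j<n. ((b j + x i v j) - (b j + x i w j))\<^sup>2) / (2 * (sqrt (N0 / 2))\<^sup>2) \<le> 4 * E / N0"
    if "v \<in> {1..M}" "w \<in> {1..M}" for v w
  proof -
    have "((b j + x i v j) - (b j + x i w j))\<^sup>2 \<le> 2 * (x i v j)\<^sup>2 + 2 * (x i w j)\<^sup>2" for j
      using sum_squares_ge_zero[of "x i v j + x i w j" 0] by (simp add: power2_eq_square algebra_simps)
    then have "(\<Sum>j<n. ((b j + x i v j) - (b j + x i w j))\<^sup>2) \<le> (\<Sum>j<n. 2 * (x i v j)\<^sup>2 + 2 * (x i w j)\<^sup>2)"
      by (intro sum_mono)
    also have "\<dots> = 2 * (\<Sum>j<n. (x i v j)\<^sup>2) + 2 * (\<Sum>j<n. (x i w j)\<^sup>2)"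
      by (simp add: sum.distrib sum_distrib_left)
    also have "\<dots> \<le> 4 * E"
      using energy[of v] energy[of w] that by simp
    finally show ?thesis using N0 by (simp add: divide_right_mono)
  qed
  show "(3/4) / (1 + exp (8 * E / N0 + ln 4)) \<le> (\<Sum>w=1..M. measure (gauss n (\<lambda>j. b j + x i w j) (sqrt (N0 / 2)))
      {y \<in> space (\<Pi>\<^sub>M j\<in>{..<n}. borel). g y i \<noteq> w}) / real M"
    using two_codewords_error_lower_bound[where c = "\<lambda>w j. b j + x i w j" and h = "\<lambda>y. g y i"
        and D = "4 * E / N0" and \<sigma> = "sqrt (N0 / 2)", OF _ M decoder_error_measurable[OF g i] dist] N0
    by simp
qed (simp_all add: add_nonneg_nonneg)

text \<open>The reference point is \<open>b\<close> itself, the output centre when user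
  \<open>i\<close> is silent. Distances to it give \<open>E / N0\<close> instead of the pairwise
  \<open>4 * E / N0\<close>, and hence the sharp constant of the capacity.\<close>

lemma APE_code_error_ge:
  assumes code: "APE_code N0 \<alpha> l n M E \<epsilon> x g" and N0: "0 < N0" and l: "1 \<le> l"
    and \<alpha>: "0 < \<alpha>" "\<alpha> \<le> 1" and s: "0 \<le> s"
    and pos: "0 \<le> 1 - exp \<gamma> / real M - exp (s * (1 + s) * (E / N0) - s * \<gamma>)"
  shows "\<alpha> * (1 - exp \<gamma> / real M - exp (s * (1 + s) * (E / N0) - s * \<gamma>)) \<le> avg_error_prob N0 \<alpha> l n M x g"
proof (rule avg_error_prob_ge[OF user_error_prob_ge[OF code N0 _ \<alpha> pos] l])
  fix i b assume i: "i < l"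
  have g: "g \<in> (\<Pi>\<^sub>M j\<in>{..<n}. borel) \<rightarrow>\<^sub>M (\<Pi>\<^sub>M i\<in>{..<l}. count_space {0..M})" and M: "1 \<le> M"
    using code by (simp_all add: APE_code_def)
  have energy: "(\<Sum>j<n. (x i w j)\<^sup>2) \<le> E" if "w \<le> M" for w
    using code i that unfolding APE_code_def by blast
  have dist: "(\<Sum>j<n. ((b j + x i w j) - b j)\<^sup>2) / (2 * (sqrt (N0 / 2))\<^sup>2) \<le> E / N0"
    if "w \<in> {1..M}" for w
    using energy[of w] that N0 by (simp add: divide_right_mono)
  show "1 - exp \<gamma> / real M - exp (s * (1 + s) * (E / N0) - s * \<gamma>) \<le>
      (\<Sum>w=1..M. measure (gauss n (\<lambda>j. b j + x i w j) (sqrt (N0 / 2)))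
      {y \<in> space (\<Pi>\<^sub>M j\<in>{..<n}. borel). g y i \<noteq> w}) / real M"
    using many_codewords_error_lower_bound[where c = "\<lambda>w j. b j + x i w j" and h = "\<lambda>y. g y i"
        and \<sigma> = "sqrt (N0 / 2)", OF _ M s decoder_error_measurable[OF g i] dist] N0
    by simp
qed

section \<open>The sum-rate converse\<close>

lemma expectation_Pi_pmf_component:
  fixes h :: "'b \<Rightarrow> real"
  assumes "finite A" "i \<in> A"
  shows "(\<integral>W. h (W i) \<partial>Pi_pmf A d p) = (\<integral>w. h w \<partial>p i)"
proof -
  have "(\<integral>w. h w \<partial>p i) = (\<integral>w. h w \<partial>map_pmf (\<lambda>W. W i) (Pi_pmf A d p))"
    using assms by (simp add: Pi_pmf_component)
  then show ?thesis by simp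
qed

text \<open>Independence removes the cross terms of the centred sum, and a variance is at most a
  second moment. Centring keeps the received power linear in the number of users; uncentred, the
  codewords could add up coherently to quadratic growth.\<close>

lemma variance_sum_Pi_pmf_le:
  fixes f :: "'a \<Rightarrow> 'b \<Rightarrow> real"
  assumes A: "finite A" and fin: "\<And>i. i \<in> A \<Longrightarrow> finite (set_pmf (p i))"
  shows "(\<integral>W. ((\<Sum>i\<in>A. f i (W i)) - (\<Sum>i\<in>A. \<integral>w. f i w \<partial>p i))\<^sup>2 \<partial>Pi_pmf A d p)
    \<le> (\<Sum>i\<in>A. \<integral>w. (f i w)\<^sup>2 \<partial>p i)"
proof -
  define P where "P = Pi_pmf A d p"
  define g where "g i w = f i w - (\<integral>w. f i w \<partial>p i)" for i w
  have finP: "finite (set_pmf P)"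
    unfolding P_def set_Pi_pmf[OF A] using A fin by (intro finite_PiE_dflt) auto
  have int: "integrable P h" for h :: "('a \<Rightarrow> 'b) \<Rightarrow> real"
    by (rule integrable_measure_pmf_finite[OF finP])
  have intp: "i \<in> A \<Longrightarrow> integrable (p i) h" for i and h :: "'b \<Rightarrow> real"
    by (rule integrable_measure_pmf_finite[OF fin])
  have g0: "(\<integral>w. g i w \<partial>p i) = 0" if "i \<in> A" for i
    using intp[OF that] by (simp add: g_def)
  have cross: "(\<integral>W. g i (W i) * g k (W k) \<partial>P) = 0" if "i \<in> A" "k \<in> A" "i \<noteq> k" for i k
  proof -
    have "prob_space.indep_vars P (\<lambda>_. borel) (\<lambda>i W. g i (W i)) A"
      unfolding P_def
      by (rule prob_space.indep_vars_compose2[OF measure_pmf.prob_space_axioms indep_vars_Pi_pmf[OF A]]) auto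
    from prob_space.indep_vars_subset[OF measure_pmf.prob_space_axioms this, of "{i, k}"]
    have "prob_space.indep_vars P (\<lambda>_. borel) (\<lambda>i W. g i (W i)) {i, k}"
      using that by simp
    then have "(\<integral>W. (\<Prod>j\<in>{i, k}. g j (W j)) \<partial>P) = (\<Prod>j\<in>{i, k}. \<integral>W. g j (W j) \<partial>P)"
      by (rule prob_space.indep_vars_lebesgue_integral[OF measure_pmf.prob_space_axioms _ _ int, rotated]) simp
    then show ?thesis
      using that g0 by (simp add: P_def expectation_Pi_pmf_component[OF A])
  qed
  have "(\<integral>W. ((\<Sum>i\<in>A. f i (W i)) - (\<Sum>i\<in>A. \<integral>w. f i w \<partial>p i))\<^sup>2 \<partial>P) =
      (\<integral>W. (\<Sum>i\<in>A. \<Sum>k\<in>A. g i (W i) * g k (W k)) \<partial>P)"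
    by (simp add: g_def power2_eq_square flip: sum_subtractf sum_product)
  also have "\<dots> = (\<Sum>i\<in>A. \<Sum>k\<in>A. \<integral>W. g i (W i) * g k (W k) \<partial>P)"
    by (simp add: int)
  also have "\<dots> = (\<Sum>i\<in>A. \<integral>W. (g i (W i))\<^sup>2 \<partial>P)"
  proof (rule sum.cong[OF refl])
    fix i assume i: "i \<in> A"
    have "(\<Sum>k\<in>A. \<integral>W. g i (W i) * g k (W k) \<partial>P) = (\<Sum>k\<in>{i}. \<integral>W. g i (W i) * g k (W k) \<partial>P)"
      using i A cross by (intro sum.mono_neutral_right) auto
    then show "(\<Sum>k\<in>A. \<integral>W. g i (W i) * g k (W k) \<partial>P) = (\<integral>W. (g i (W i))\<^sup>2 \<partial>P)"
      by (simp add: power2_eq_square)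
  qed
  also have "\<dots> = (\<Sum>i\<in>A. \<integral>w. (g i w)\<^sup>2 \<partial>p i)"
    unfolding P_def by (intro sum.cong refl expectation_Pi_pmf_component A) auto
  also have "\<dots> \<le> (\<Sum>i\<in>A. \<integral>w. (f i w)\<^sup>2 \<partial>p i)"
  proof (rule sum_mono)
    fix i assume i: "i \<in> A"
    have "(\<integral>w. (g i w)\<^sup>2 \<partial>p i) = (\<integral>w. (f i w)\<^sup>2 \<partial>p i) - (\<integral>w. f i w \<partial>p i)\<^sup>2"
      unfolding g_def by (rule measure_pmf.variance_eq) (simp_all add: intp[OF i])
    then show "(\<integral>w. (g i w)\<^sup>2 \<partial>p i) \<le> (\<integral>w. (f i w)\<^sup>2 \<partial>p i)" by simp
  qed
  finally show ?thesis by (simp add: P_def)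
qed

section \<open>Second moments and the Gaussian entropy bound\<close>

lemma normal_second_moment:
  assumes \<sigma>: "0 < \<sigma>"
  shows "(\<integral>\<^sup>+z. ennreal ((z - m)\<^sup>2) \<partial>density lborel (\<lambda>z. ennreal (normal_density c \<sigma> z)))
    = ennreal (\<sigma>\<^sup>2 + (c - m)\<^sup>2)"
proof -
  have "has_bochner_integral lborel (\<lambda>z. normal_density c \<sigma> z * (z - c)\<^sup>2 +
      2 * (c - m) * (normal_density c \<sigma> z * (z - c)) + (c - m)\<^sup>2 * normal_density c \<sigma> z)
      (\<sigma>\<^sup>2 + 2 * (c - m) * 0 + (c - m)\<^sup>2 * 1)"
    using normal_moment_even[OF \<sigma>, of c 1] normal_moment_odd[OF \<sigma>, of c 0] \<sigma>
      has_bochner_integral_integrable[OF integrable_normal_density[OF \<sigma>, of c]]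
    by (intro has_bochner_integral_add has_bochner_integral_mult_right) (simp_all add: integral_normal_density[OF \<sigma>])
  moreover have "normal_density c \<sigma> z * (z - c)\<^sup>2 +
      2 * (c - m) * (normal_density c \<sigma> z * (z - c)) + (c - m)\<^sup>2 * normal_density c \<sigma> z =
      normal_density c \<sigma> z * (z - m)\<^sup>2" for z
    by (simp add: power2_eq_square algebra_simps)
  ultimately have h: "has_bochner_integral lborel (\<lambda>z. normal_density c \<sigma> z * (z - m)\<^sup>2) (\<sigma>\<^sup>2 + (c - m)\<^sup>2)"
    by simp
  have "(\<integral>\<^sup>+z. ennreal ((z - m)\<^sup>2) \<partial>density lborel (\<lambda>z. ennreal (normal_density c \<sigma> z))) =
      (\<integral>\<^sup>+z. ennreal (normal_density c \<sigma> z * (z - m)\<^sup>2) \<partial>lborel)"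
    by (subst nn_integral_density) (simp_all add: ennreal_mult)
  also have "\<dots> = ennreal (\<integral>z. normal_density c \<sigma> z * (z - m)\<^sup>2 \<partial>lborel)"
    using h by (intro nn_integral_eq_integral) (auto simp: has_bochner_integral_iff)
  finally show ?thesis using h by (simp add: has_bochner_integral_iff)
qed

lemma gauss_second_moment:
  assumes \<sigma>: "0 < \<sigma>"
  shows "(\<integral>\<^sup>+y. ennreal (\<Sum>j<n. (y j - m j)\<^sup>2) \<partial>gauss n c \<sigma>) =
    ennreal (n * \<sigma>\<^sup>2 + (\<Sum>j<n. (c j - m j)\<^sup>2))"
proof -
  have "(\<integral>\<^sup>+y. ennreal ((y j - m j)\<^sup>2) \<partial>gauss n c \<sigma>) = ennreal (\<sigma>\<^sup>2 + (c j - m j)\<^sup>2)" if "j < n" for j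
  proof -
    have "(\<integral>\<^sup>+y. ennreal ((y j - m j)\<^sup>2) \<partial>gauss n c \<sigma>) =
        (\<integral>\<^sup>+z. ennreal ((z - m j)\<^sup>2) \<partial>distr (gauss n c \<sigma>) borel (\<lambda>y. y j))"
      using that by (subst nn_integral_distr) auto
    then show ?thesis
      using that by (simp only: distr_gauss_component[OF \<sigma>] normal_second_moment[OF \<sigma>])
  qed
  then have "(\<Sum>j<n. \<integral>\<^sup>+y. ennreal ((y j - m j)\<^sup>2) \<partial>gauss n c \<sigma>) = (\<Sum>j<n. ennreal (\<sigma>\<^sup>2 + (c j - m j)\<^sup>2))"
    by simp
  also have "(\<Sum>j<n. \<integral>\<^sup>+y. ennreal ((y j - m j)\<^sup>2) \<partial>gauss n c \<sigma>) =
      (\<integral>\<^sup>+y. ennreal (\<Sum>j<n. (y j - m j)\<^sup>2) \<partial>gauss n c \<sigma>)"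
    by (subst nn_integral_sum[symmetric]) auto
  finally show ?thesis by (simp add: sum.distrib sum_nonneg ennreal_plus[symmetric] del: ennreal_plus)
qed

text \<open>Pointwise form of the Donsker--Varadhan inequality \<open>E\<^sub>P F \<le> KL(P, Q) + ln E\<^sub>Q (exp F)\<close>, with
  the log-likelihood ratio replaced by a nonnegative upper bound, so that it can be integrated
  without integrability conditions.\<close>

lemma gauss_density_entropy_bound:
  fixes n :: nat and a m :: "nat \<Rightarrow> real"
  assumes \<sigma>: "0 < \<sigma>" "\<sigma> \<le> s"
  shows "F * gauss_density n a \<sigma> y \<le>
    (n * ln (s / \<sigma>) + c + (\<Sum>j<n. (y j - m j)\<^sup>2) / (2 * s\<^sup>2)) * gauss_density n a \<sigma> y
    + exp (- c) * (exp F * gauss_density n m s y)"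
proof -
  define p where "p = gauss_density n a \<sigma> y"
  define R where "R = (\<Sum>j<n. (y j - m j)\<^sup>2) / (2 * s\<^sup>2)"
  define L where "L = n * ln (s / \<sigma>) + R"
  have s: "0 < s" using \<sigma> by simp
  have p0: "0 \<le> p" by (simp add: p_def)
  \<comment> \<open>Bounding \<open>p\<close> by its peak value makes \<open>L\<close> an upper
    bound of the log-likelihood ratio against the reference density of mean \<open>m\<close>; it is
    nonnegative since \<open>\<sigma> \<le> s\<close>.\<close>
  have "p \<le> (1 / sqrt (2 * pi * \<sigma>\<^sup>2)) ^ n"
    unfolding p_def gauss_density_def
    by (intro mult_left_le) (auto intro!: divide_nonneg_nonneg sum_nonneg)
  then have "p * exp (- L) \<le> (1 / sqrt (2 * pi * \<sigma>\<^sup>2)) ^ n * exp (- L)"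
    by (intro mult_right_mono) auto
  moreover have "(1 / sqrt (2 * pi * \<sigma>\<^sup>2)) ^ n * exp (- L) = gauss_density n m s y"
  proof -
    have "- (n * ln (s / \<sigma>)) = real n * ln (\<sigma> / s)"
      using \<sigma> s by (simp add: ln_div algebra_simps)
    then have "exp (- (n * ln (s / \<sigma>))) = exp (ln (\<sigma> / s)) ^ n"
      by (simp only: exp_of_nat_mult)
    moreover have "exp (- L) = exp (- (n * ln (s / \<sigma>))) * exp (- R)"
      by (simp add: L_def exp_add[symmetric])
    ultimately have "exp (- L) = (\<sigma> / s) ^ n * exp (- R)"
      using \<sigma> s by simp
    moreover have "1 / sqrt (2 * pi * \<sigma>\<^sup>2) * (\<sigma> / s) = 1 / sqrt (2 * pi * s\<^sup>2)"
      using \<sigma> s by (simp add: real_sqrt_mult)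
    ultimately show ?thesis
      unfolding gauss_density_def minus_divide_left[symmetric] R_def[symmetric]
      by (simp only: power_mult_distrib[symmetric] mult.assoc[symmetric])
  qed
  ultimately have pL: "p * exp (- L) \<le> gauss_density n m s y" by simp
  \<comment> \<open>The inequality \<open>t \<le> exp t\<close> plays the role of convex duality;
    \<open>c\<close> is free and will be the logarithm of a bound on the exponential moment.\<close>
  have "F - c - L \<le> exp (F - c - L)"
    using exp_ge_add_one_self[of "F - c - L"] by linarith
  then have "(F - c - L) * p \<le> exp (F - c - L) * p"
    using p0 by (intro mult_right_mono)
  also have "exp (F - c - L) * p = exp (F - c) * (p * exp (- L))"
    by (simp add: mult.commute mult.left_commute flip: exp_add)
  also have "\<dots> \<le> exp (F - c) * gauss_density n m s y"
    using pL by (intro mult_left_mono) auto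
  also have "\<dots> = exp (- c) * (exp F * gauss_density n m s y)"
    by (simp add: mult.assoc[symmetric] flip: exp_add)
  finally show ?thesis
    unfolding p_def[symmetric] R_def[symmetric] by (simp add: L_def algebra_simps)
qed

text \<open>The preceding bound integrated; its quadratic term becomes the second moment about
  \<open>m\<close>. Since \<open>\<sigma> \<le> s\<close> and \<open>0 \<le> c\<close>, all terms
  are nonnegative, so the inequality makes sense in the extended reals even if the exponential
  moment is infinite.\<close>

lemma gauss_entropy_bound:
  fixes F :: "(nat \<Rightarrow> real) \<Rightarrow> real"
  assumes \<sigma>: "0 < \<sigma>" "\<sigma> \<le> s" and c: "0 \<le> c"
    and F: "F \<in> borel_measurable (\<Pi>\<^sub>M j\<in>{..<n}. borel)" "\<And>y. 0 \<le> F y"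
  shows "(\<integral>\<^sup>+y. ennreal (F y) \<partial>gauss n a \<sigma>) \<le>
    ennreal (n * ln (s / \<sigma>) + c + (n * \<sigma>\<^sup>2 + (\<Sum>j<n. (a j - m j)\<^sup>2)) / (2 * s\<^sup>2)) +
    ennreal (exp (- c)) * (\<integral>\<^sup>+y. ennreal (exp (F y)) \<partial>gauss n m s)"
proof -
  define B :: "(nat \<Rightarrow> real) measure" where "B = (\<Pi>\<^sub>M j\<in>{..<n}. borel)"
  define L :: "(nat \<Rightarrow> real) measure" where "L = (\<Pi>\<^sub>M j\<in>{..<n}. lborel)"
  have s: "0 < s" using \<sigma> by simp
  interpret G: prob_space "gauss n a \<sigma>" by (rule prob_space_gauss[OF \<sigma>(1)])
  define A where "A = n * ln (s / \<sigma>) + c"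
  have "0 \<le> ln (s / \<sigma>)" using \<sigma> by simp
  then have A: "0 \<le> A" using c by (simp add: A_def)
  define R where "R y = (\<Sum>j<n. (y j - m j)\<^sup>2) / (2 * s\<^sup>2)" for y
  have R0: "0 \<le> R y" for y by (simp add: R_def sum_nonneg)
  have sq: "(\<lambda>y. \<Sum>j<n. (y j - m j)\<^sup>2) \<in> borel_measurable B"
    unfolding B_def by measurable
  then have R: "R \<in> borel_measurable B"
    unfolding R_def[abs_def] by measurable
  have LB': "borel_measurable L = (borel_measurable B :: ((nat \<Rightarrow> real) \<Rightarrow> real) set)"
    "borel_measurable L = (borel_measurable B :: ((nat \<Rightarrow> real) \<Rightarrow> ennreal) set)"
    unfolding L_def B_def by (rule measurable_cong_sets[OF sets_lborel_PiM refl])+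
  have d: "gauss_density n b t \<in> borel_measurable B" for b t
    unfolding B_def by measurable
  have F': "F \<in> borel_measurable B" using F by (simp add: B_def)
  have "(\<integral>\<^sup>+y. ennreal (F y) \<partial>gauss n a \<sigma>) = (\<integral>\<^sup>+y. ennreal (gauss_density n a \<sigma> y) * ennreal (F y) \<partial>L)"
    unfolding L_def using F' by (intro nn_integral_gauss \<sigma>) (auto simp: B_def)
  also have "\<dots> \<le> (\<integral>\<^sup>+y. ennreal (gauss_density n a \<sigma> y) * ennreal (A + R y) +
      ennreal (exp (- c)) * (ennreal (gauss_density n m s y) * ennreal (exp (F y))) \<partial>L)"
  proof (rule nn_integral_mono)
    fix y
    have "gauss_density n a \<sigma> y * F y \<le> gauss_density n a \<sigma> y * (A + R y) +
        exp (- c) * (gauss_density n m s y * exp (F y))"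
      using gauss_density_entropy_bound[OF \<sigma>, of "F y" n a y c m]
      by (simp add: A_def R_def mult.commute)
    then have "ennreal (gauss_density n a \<sigma> y * F y) \<le> ennreal (gauss_density n a \<sigma> y * (A + R y) +
        exp (- c) * (gauss_density n m s y * exp (F y)))"
      by (rule ennreal_leI)
    then show "ennreal (gauss_density n a \<sigma> y) * ennreal (F y) \<le>
      ennreal (gauss_density n a \<sigma> y) * ennreal (A + R y) +
      ennreal (exp (- c)) * (ennreal (gauss_density n m s y) * ennreal (exp (F y)))"
      using A R0[of y] F(2)[of y] by (simp only: ennreal_mult[symmetric] ennreal_plus[symmetric]
        gauss_density_nonneg exp_ge_zero mult_nonneg_nonneg add_nonneg_nonneg)
  qed
  also have "\<dots> = (\<integral>\<^sup>+y. ennreal (gauss_density n a \<sigma> y) * ennreal (A + R y) \<partial>L) +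
      ennreal (exp (- c)) * (\<integral>\<^sup>+y. ennreal (gauss_density n m s y) * ennreal (exp (F y)) \<partial>L)"
    using R d F' by (subst nn_integral_add) (simp_all add: LB' nn_integral_cmult)
  also have "(\<integral>\<^sup>+y. ennreal (gauss_density n m s y) * ennreal (exp (F y)) \<partial>L) =
      (\<integral>\<^sup>+y. ennreal (exp (F y)) \<partial>gauss n m s)"
    unfolding L_def using F' by (intro nn_integral_gauss[symmetric] s) (auto simp: B_def)
  also have "(\<integral>\<^sup>+y. ennreal (gauss_density n a \<sigma> y) * ennreal (A + R y) \<partial>L) =
      (\<integral>\<^sup>+y. ennreal (A + R y) \<partial>gauss n a \<sigma>)"
    unfolding L_def using R by (intro nn_integral_gauss[symmetric] \<sigma>) (auto simp: B_def)
  also have "\<dots> = (\<integral>\<^sup>+y. ennreal A + ennreal (1 / (2 * s\<^sup>2)) * ennreal (\<Sum>j<n. (y j - m j)\<^sup>2) \<partial>gauss n a \<sigma>)"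
    using A R0 by (intro nn_integral_cong)
      (simp add: R_def ennreal_mult[symmetric] ennreal_plus[symmetric] sum_nonneg del: ennreal_plus)
  also have "\<dots> = ennreal A + ennreal (1 / (2 * s\<^sup>2)) * (\<integral>\<^sup>+y. ennreal (\<Sum>j<n. (y j - m j)\<^sup>2) \<partial>gauss n a \<sigma>)"
    using sq by (subst nn_integral_add)
      (auto simp: B_def nn_integral_cmult G.emeasure_space_1)
  also have "\<dots> = ennreal (A + (n * \<sigma>\<^sup>2 + (\<Sum>j<n. (a j - m j)\<^sup>2)) / (2 * s\<^sup>2))"
    unfolding gauss_second_moment[OF \<sigma>(1)] using A
    by (simp add: ennreal_mult[symmetric] ennreal_plus[symmetric] sum_nonneg del: ennreal_plus)
  finally show ?thesis unfolding A_def .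
qed

text \<open>A fixed guess \<open>v i\<close> hits an active message with probability at most
  \<open>\<alpha> / M\<close>; the reward \<open>M\<close> turns this into at most
  \<open>\<alpha>\<close>, and the remaining mass contributes at most 1. So each factor has mean at
  most 2, and independence multiplies the factors.\<close>

lemma messages_guess_moment:
  fixes M :: nat
  assumes \<alpha>: "0 < \<alpha>" "\<alpha> \<le> 1" and M: "1 \<le> M"
  shows "(\<integral>\<^sup>+W. ennreal (exp (ln (real M) * (\<Sum>i<l. if W i \<noteq> 0 \<and> v i = W i then 1 else 0))) \<partial>messages_pmf \<alpha> M l)
    \<le> ennreal (2 ^ l)"
proof -
  define h where "h i w = (if w \<noteq> 0 \<and> v i = w then real M else 1)" for i w
  have h: "(\<integral>\<^sup>+w. ennreal (h i w) \<partial>message_pmf \<alpha> M) \<le> 2" for i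
  proof -
    have "(\<integral>\<^sup>+w. ennreal (h i w) \<partial>message_pmf \<alpha> M) =
        (\<Sum>w\<in>{0..M}. ennreal (h i w) * ennreal (pmf (message_pmf \<alpha> M) w))"
      using set_message_pmf_subset[of \<alpha> M] \<alpha> M by (intro nn_integral_measure_pmf_support) auto
    also have "\<dots> = ennreal (\<Sum>w\<in>{0..M}. h i w * pmf (message_pmf \<alpha> M) w)"
      by (simp add: h_def ennreal_mult[symmetric] sum_ennreal)
    finally have eq: "(\<integral>\<^sup>+w. ennreal (h i w) \<partial>message_pmf \<alpha> M) =
        ennreal (\<Sum>w\<in>{0..M}. h i w * pmf (message_pmf \<alpha> M) w)" .
    have "\<alpha> \<le> \<alpha> / real M + 1"
      using \<alpha> by (simp add: add_increasing)
    then have "(\<Sum>w\<in>{0..M}. h i w * pmf (message_pmf \<alpha> M) w) \<le>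
        (\<Sum>w\<in>{0..M}. pmf (message_pmf \<alpha> M) w + (if v i = w then 1 else 0))"
      using \<alpha> M by (intro sum_mono) (auto simp: h_def pmf_message_pmf)
    also have "\<dots> \<le> 2"
      using set_message_pmf_subset[of \<alpha> M] \<alpha> M
      by (simp add: sum.distrib sum_pmf_eq_1)
    finally show ?thesis unfolding eq using ennreal_leI by fastforce
  qed
  have "exp (ln (real M) * (\<Sum>i<l. if W i \<noteq> 0 \<and> v i = W i then 1 else 0)) = (\<Prod>i<l. h i (W i))" for W
    using M by (simp add: sum_distrib_left exp_sum h_def if_distrib[of exp] if_distrib cong: if_cong)
  then have "(\<integral>\<^sup>+W. ennreal (exp (ln (real M) * (\<Sum>i<l. if W i \<noteq> 0 \<and> v i = W i then 1 else 0))) \<partial>messages_pmf \<alpha> M l)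
      = (\<integral>\<^sup>+W. (\<Prod>i<l. ennreal (h i (W i))) \<partial>messages_pmf \<alpha> M l)"
    by (simp add: h_def prod_ennreal)
  also have "\<dots> = (\<Prod>i<l. \<integral>\<^sup>+w. ennreal (h i w) \<partial>message_pmf \<alpha> M)"
    unfolding messages_pmf_def by (intro nn_integral_prod_Pi_pmf) simp
  also have "\<dots> \<le> (\<Prod>i<l. 2)" using h by (intro prod_mono_ennreal)
  also have "\<dots> = ennreal (2 ^ l)" by (simp add: ennreal_power[symmetric])
  finally show ?thesis .
qed

text \<open>The entropy bound is applied to \<open>F = ln M * (number of active users decoded correctly)\<close> and to the
  Gaussian reference distribution with the mean and an upper bound of the variance of the received
  vector. The inactive users must not be counted in \<open>F\<close>: guessing them is easy, so its exponential
  moment under independent messages would not be bounded by \<open>2 ^ l\<close>.\<close>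

lemma APE_code_sum_rate:
  assumes code: "APE_code N0 \<alpha> l n M E \<epsilon> x g" and N0: "0 < N0" and n: "1 \<le> n" and l: "1 \<le> l"
    and \<alpha>: "0 < \<alpha>" "\<alpha> \<le> 1"
  shows "real l * (\<alpha> - avg_error_prob N0 \<alpha> l n M x g) * ln (real M) \<le>
    real n / 2 * ln (1 + 2 * real l * E / (real n * N0)) + real n / 2 + real l * ln 2 + 1"
proof -
  define B :: "(nat \<Rightarrow> real) measure" where "B = (\<Pi>\<^sub>M j\<in>{..<n}. borel)"
  define P where "P = messages_pmf \<alpha> M l"
  define p where "p = message_pmf \<alpha> M"
  define \<sigma> where "\<sigma> = sqrt (N0 / 2)"
  \<comment> \<open>The reference variance is the noise variance plus \<open>l * E / n\<close>,
    which bounds the variance of the transmitted sum averaged over the coordinates.\<close>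
  define s where "s = sqrt (N0 / 2 + real l * E / real n)"
  \<comment> \<open>\<open>exp c = 2 ^ l\<close> is the bound on the exponential moment, so the last
    term of the entropy bound averages to at most 1.\<close>
  define c where "c = real l * ln 2"
  define X where "X W = codeword_sum l x W" for W
  define m where "m j = (\<Sum>i<l. \<integral>w. x i w j \<partial>p)" for j
  define S where "S i w = {y \<in> space B. g y i = w}" for i and w :: nat
  define G where "G W i = (if W i = 0 then 0 else measure (gauss n (X W) \<sigma>) (S i (W i)))" for W i
  define F where "F W y = ln (real M) * (\<Sum>i<l. if W i = 0 then 0 else indicator (S i (W i)) y)" for W y
  have M: "1 \<le> M" and E: "0 < E"
    and g: "g \<in> (\<Pi>\<^sub>M j\<in>{..<n}. borel) \<rightarrow>\<^sub>M (\<Pi>\<^sub>M i\<in>{..<l}. count_space {0..M})"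
    using code by (simp_all add: APE_code_def)
  have energy: "(\<Sum>j<n. (x i w j)\<^sup>2) \<le> E" if "i < l" "w \<le> M" for i w
    using code that unfolding APE_code_def by blast
  have lnM: "0 \<le> ln (real M)" using M by simp
  have \<sigma>: "0 < \<sigma>" using N0 by (simp add: \<sigma>_def)
  have \<sigma>2: "\<sigma>\<^sup>2 = N0 / 2" using N0 by (simp add: \<sigma>_def)
  have lEn: "0 \<le> real l * E / real n" using E by simp
  have s2: "s\<^sup>2 = N0 / 2 + real l * E / real n" using lEn N0 by (simp add: s_def)
  have \<sigma>s: "\<sigma> \<le> s" unfolding \<sigma>_def s_def using lEn by (intro real_sqrt_le_mono) simp
  have s: "0 < s" using \<sigma> \<sigma>s by simp
  have finP: "finite (set_pmf P)"
    unfolding P_def using \<alpha> M by (intro finite_set_messages_pmf) auto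
  have finp: "finite (set_pmf p)"
    unfolding p_def using \<alpha> M set_message_pmf_subset[of \<alpha> M] by (auto intro: finite_subset)
  have intP: "integrable P h" for h :: "(nat \<Rightarrow> nat) \<Rightarrow> real"
    by (rule integrable_measure_pmf_finite[OF finP])
  have intp: "integrable p h" for h :: "nat \<Rightarrow> real"
    by (rule integrable_measure_pmf_finite[OF finp])
  have S: "S i w \<in> sets B" if "i < l" for i w
  proof -
    have "S i w = space B - {y \<in> space B. g y i \<noteq> w}" by (auto simp: S_def)
    then show ?thesis using decoder_error_measurable[OF g that, of w] by (auto simp: B_def)
  qed
  have ind: "indicator (S i w) \<in> borel_measurable B" if "i < l" for i w
    using S[OF that] by (rule borel_measurable_indicator)
  have F: "F W \<in> borel_measurable B" for W
  proof -
    have "(\<lambda>y. if W i = 0 then 0 else indicator (S i (W i)) y :: real) \<in> borel_measurable B" if "i < l" for i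
      using ind[OF that] by (cases "W i = 0") simp_all
    then show ?thesis
      unfolding F_def by (intro borel_measurable_times borel_measurable_sum) auto
  qed
  have F0: "0 \<le> F W y" for W y
    unfolding F_def using lnM by (intro mult_nonneg_nonneg sum_nonneg) auto
  have G0: "0 \<le> G W i" for W i by (simp add: G_def)

  have FG: "(\<integral>\<^sup>+y. ennreal (F W y) \<partial>gauss n (X W) \<sigma>) = ennreal (ln (real M) * (\<Sum>i<l. G W i))" for W
  proof -
    interpret gs: prob_space "gauss n (X W) \<sigma>" by (rule prob_space_gauss[OF \<sigma>])
    have i: "integrable (gauss n (X W) \<sigma>) (\<lambda>y. if W i = 0 then 0 else indicator (S i (W i)) y :: real)" if "i < l" for i
      using S[OF that, of "W i"] by (cases "W i = 0") (simp_all add: B_def gs.emeasure_eq_measure)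
    have "(\<integral>y. (if W i = 0 then 0 else indicator (S i (W i)) y) \<partial>gauss n (X W) \<sigma>) = G W i" if "i < l" for i
      using S[OF that, of "W i"] sets.sets_into_space[OF S[OF that, of "W i"]]
      by (cases "W i = 0") (simp_all add: G_def B_def space_gauss Int_absorb2)
    then have "(\<integral>y. F W y \<partial>gauss n (X W) \<sigma>) = ln (real M) * (\<Sum>i<l. G W i)"
      unfolding F_def using i by (simp add: Bochner_Integration.integral_sum)
    moreover have "integrable (gauss n (X W) \<sigma>) (F W)"
      unfolding F_def using i by (intro integrable_mult_right Bochner_Integration.integrable_sum) auto
    ultimately show ?thesis using F0 by (subst nn_integral_eq_integral) auto
  qed

  have step: "ennreal (ln (real M) * (\<Sum>i<l. G W i)) \<le>
      ennreal (real n * ln (s / \<sigma>) + c + (real n * \<sigma>\<^sup>2 + (\<Sum>j<n. (X W j - m j)\<^sup>2)) / (2 * s\<^sup>2)) +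
      ennreal (exp (- c)) * (\<integral>\<^sup>+y. ennreal (exp (F W y)) \<partial>gauss n m s)" for W
    unfolding FG[symmetric] using F F0 by (intro gauss_entropy_bound \<sigma> \<sigma>s) (auto simp: c_def B_def)

  \<comment> \<open>Under the reference law the output is independent of the messages. After
    exchanging the integrals, \<open>y\<close> and with it the guess \<open>g y\<close> are fixed
    while \<open>W\<close> is averaged.\<close>
  have "(\<integral>\<^sup>+W. \<integral>\<^sup>+y. ennreal (exp (F W y)) \<partial>gauss n m s \<partial>P) =
      (\<Sum>W\<in>set_pmf P. \<integral>\<^sup>+y. ennreal (exp (F W y)) * pmf P W \<partial>gauss n m s)"
    using F by (simp add: nn_integral_measure_pmf_finite[OF finP] nn_integral_multc B_def)
  also have "\<dots> = (\<integral>\<^sup>+y. (\<Sum>W\<in>set_pmf P. ennreal (exp (F W y)) * pmf P W) \<partial>gauss n m s)"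
    using F by (intro nn_integral_sum[symmetric]) (simp add: B_def)
  also have "\<dots> = (\<integral>\<^sup>+y. \<integral>\<^sup>+W. ennreal (exp (F W y)) \<partial>P \<partial>gauss n m s)"
    by (simp add: nn_integral_measure_pmf_finite[OF finP])
  also have "\<dots> \<le> (\<integral>\<^sup>+y. ennreal (2 ^ l) \<partial>gauss n m s)"
  proof (rule nn_integral_mono)
    fix y assume "y \<in> space (gauss n m s)"
    then have y: "y \<in> space B" by (simp add: space_gauss B_def)
    have "(\<Sum>i<l. if W i = 0 then 0 else indicator (S i (W i)) y :: real) =
        (\<Sum>i<l. if W i \<noteq> 0 \<and> g y i = W i then 1 else 0)" for W
      using y by (intro sum.cong) (auto simp: S_def)
    then show "(\<integral>\<^sup>+W. ennreal (exp (F W y)) \<partial>P) \<le> ennreal (2 ^ l)"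
      unfolding F_def P_def using messages_guess_moment[OF \<alpha> M, of l "g y"] by simp
  qed
  also have "\<dots> = ennreal (exp c)"
    using prob_space.emeasure_space_1[OF prob_space_gauss[OF s]]
    by (simp add: c_def exp_of_nat_mult)
  finally have moment: "(\<integral>\<^sup>+W. \<integral>\<^sup>+y. ennreal (exp (F W y)) \<partial>gauss n m s \<partial>P) \<le> ennreal (exp c)" .

  have var: "(\<integral>W. (\<Sum>j<n. (X W j - m j)\<^sup>2) \<partial>P) \<le> real l * E"
  proof -
    have "(\<integral>W. (\<Sum>j<n. (X W j - m j)\<^sup>2) \<partial>P) = (\<Sum>j<n. \<integral>W. (X W j - m j)\<^sup>2 \<partial>P)"
      by (simp add: intP)
    also have "\<dots> \<le> (\<Sum>j<n. \<Sum>i<l. \<integral>w. (x i w j)\<^sup>2 \<partial>p)"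
      unfolding X_def m_def P_def messages_pmf_def p_def[symmetric]
      by (intro sum_mono variance_sum_Pi_pmf_le) (auto simp: finp)
    also have "\<dots> = (\<Sum>i<l. \<Sum>j<n. \<integral>w. (x i w j)\<^sup>2 \<partial>p)" by (rule sum.swap)
    also have "\<dots> = (\<Sum>i<l. \<integral>w. (\<Sum>j<n. (x i w j)\<^sup>2) \<partial>p)" by (simp add: intp)
    also have "\<dots> \<le> (\<Sum>i<l. E)"
    proof (rule sum_mono)
      fix i assume i: "i \<in> {..<l}"
      have "AE w in p. (\<Sum>j<n. (x i w j)\<^sup>2) \<le> E"
        unfolding p_def using i energy set_message_pmf_subset[of \<alpha> M] \<alpha> M by (intro AE_pmfI) force
      then have "(\<integral>w. (\<Sum>j<n. (x i w j)\<^sup>2) \<partial>p) \<le> (\<integral>w. E \<partial>p)"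
        by (intro integral_mono_AE intp)
      then show "(\<integral>w. (\<Sum>j<n. (x i w j)\<^sup>2) \<partial>p) \<le> E" by simp
    qed
    finally show ?thesis by simp
  qed

  \<comment> \<open>An active user that is not decoded correctly contributes to the error, so being
    active and correct has probability at least \<open>\<alpha>\<close> minus the error
    probability.\<close>
  have err: "(\<integral>W. G W i \<partial>P) \<ge> \<alpha> - user_error_prob N0 \<alpha> l n M x g i" if i: "i < l" for i
  proof -
    have "G W i \<ge> (if W i = 0 then 0 else 1) -
        measure (gauss n (codeword_sum l x W) (sqrt (N0 / 2))) {y \<in> space (\<Pi>\<^sub>M j\<in>{..<n}. borel). g y i \<noteq> W i}" for W
    proof -
      have "{y \<in> space B. g y i \<noteq> W i} = space (gauss n (X W) \<sigma>) - S i (W i)"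
        by (auto simp: S_def B_def space_gauss)
      then show ?thesis
        using prob_space.prob_compl[OF prob_space_gauss[OF \<sigma>], of "S i (W i)" n "X W"] S[OF i]
          prob_space.prob_le_1[OF prob_space_gauss[OF \<sigma>], of n "X W" "S i (W i)"]
        by (auto simp: G_def B_def X_def \<sigma>_def)
    qed
    then have "(\<integral>W. (if W i = 0 then 0 else 1) -
        measure (gauss n (codeword_sum l x W) (sqrt (N0 / 2))) {y \<in> space (\<Pi>\<^sub>M j\<in>{..<n}. borel). g y i \<noteq> W i} \<partial>P)
        \<le> (\<integral>W. G W i \<partial>P)"
      by (intro integral_mono intP)
    moreover have "(\<integral>W. (if W i = 0 then 0 else (1::real)) \<partial>P) = \<alpha>"
    proof -
      have "(\<integral>W. (if W i = 0 then 0 else (1::real)) \<partial>P) = (\<integral>w. (if w = 0 then 0 else (1::real)) \<partial>p)"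
        unfolding P_def messages_pmf_def p_def
        using i expectation_Pi_pmf_component[where A = "{..<l}" and i = i and d = 0
          and h = "\<lambda>w. if w = 0 then 0 else 1" and p = "\<lambda>_. message_pmf \<alpha> M"] by simp
      also have "\<dots> = (\<integral>w. 1 - indicator {0} w \<partial>p)"
        by (intro Bochner_Integration.integral_cong) (auto simp: indicator_def)
      also have "\<dots> = 1 - pmf p 0"
        by (simp add: intp measure_pmf_single)
      also have "\<dots> = \<alpha>"
        using \<alpha> M by (simp add: p_def pmf_message_pmf)
      finally show ?thesis .
    qed
    ultimately show ?thesis
      by (simp add: intP user_error_prob_eq[OF code N0 i] P_def[symmetric])
  qed
  define A where "A = real n * ln (s / \<sigma>) + c"
  have A0: "0 \<le> A" using \<sigma> \<sigma>s by (simp add: A_def c_def)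
  have "ennreal (\<integral>W. ln (real M) * (\<Sum>i<l. G W i) \<partial>P) = (\<integral>\<^sup>+W. ennreal (ln (real M) * (\<Sum>i<l. G W i)) \<partial>P)"
    using lnM G0 by (intro nn_integral_eq_integral[symmetric] intP) (auto intro!: AE_pmfI mult_nonneg_nonneg sum_nonneg)
  also have "\<dots> \<le> (\<integral>\<^sup>+W. ennreal (A + (real n * \<sigma>\<^sup>2 + (\<Sum>j<n. (X W j - m j)\<^sup>2)) / (2 * s\<^sup>2)) +
      ennreal (exp (- c)) * (\<integral>\<^sup>+y. ennreal (exp (F W y)) \<partial>gauss n m s) \<partial>P)"
    unfolding A_def by (intro nn_integral_mono step)
  also have "\<dots> = (\<integral>\<^sup>+W. ennreal (A + (real n * \<sigma>\<^sup>2 + (\<Sum>j<n. (X W j - m j)\<^sup>2)) / (2 * s\<^sup>2)) \<partial>P) +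
      ennreal (exp (- c)) * (\<integral>\<^sup>+W. \<integral>\<^sup>+y. ennreal (exp (F W y)) \<partial>gauss n m s \<partial>P)"
    by (simp add: nn_integral_add nn_integral_cmult)
  also have "\<dots> \<le> (\<integral>\<^sup>+W. ennreal (A + (real n * \<sigma>\<^sup>2 + (\<Sum>j<n. (X W j - m j)\<^sup>2)) / (2 * s\<^sup>2)) \<partial>P) +
      ennreal (exp (- c)) * ennreal (exp c)"
    by (intro add_left_mono mult_left_mono moment) simp
  also have "ennreal (exp (- c)) * ennreal (exp c) = 1"
    by (simp add: ennreal_mult[symmetric] exp_add[symmetric])
  also have "(\<integral>\<^sup>+W. ennreal (A + (real n * \<sigma>\<^sup>2 + (\<Sum>j<n. (X W j - m j)\<^sup>2)) / (2 * s\<^sup>2)) \<partial>P) =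
      ennreal (\<integral>W. A + (real n * \<sigma>\<^sup>2 + (\<Sum>j<n. (X W j - m j)\<^sup>2)) / (2 * s\<^sup>2) \<partial>P)"
    using A0 by (intro nn_integral_eq_integral intP AE_pmfI add_nonneg_nonneg divide_nonneg_nonneg mult_nonneg_nonneg sum_nonneg) auto
  also have "(\<integral>W. A + (real n * \<sigma>\<^sup>2 + (\<Sum>j<n. (X W j - m j)\<^sup>2)) / (2 * s\<^sup>2) \<partial>P) =
      A + (real n * \<sigma>\<^sup>2 + (\<integral>W. (\<Sum>j<n. (X W j - m j)\<^sup>2) \<partial>P)) / (2 * s\<^sup>2)"
    by (simp add: intP del: Bochner_Integration.integral_sum)
  also have "ennreal \<dots> + 1 = ennreal (\<dots> + 1)"
    using A0 by (subst ennreal_plus)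
      (auto intro!: add_nonneg_nonneg divide_nonneg_nonneg mult_nonneg_nonneg integral_nonneg_AE AE_pmfI sum_nonneg)
  finally have "(\<integral>W. ln (real M) * (\<Sum>i<l. G W i) \<partial>P) \<le>
      A + (real n * \<sigma>\<^sup>2 + (\<integral>W. (\<Sum>j<n. (X W j - m j)\<^sup>2) \<partial>P)) / (2 * s\<^sup>2) + 1"
    using A0 by (subst (asm) ennreal_le_iff)
      (auto intro!: add_nonneg_nonneg divide_nonneg_nonneg mult_nonneg_nonneg integral_nonneg_AE AE_pmfI sum_nonneg)
  also have "\<dots> \<le> A + (real n * \<sigma>\<^sup>2 + real l * E) / (2 * s\<^sup>2) + 1"
    using var by (intro add_mono divide_right_mono) auto
  \<comment> \<open>The choice of \<open>s\<close> makes the numerator exactly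
    \<open>n * s\<^sup>2\<close>.\<close>
  also have "(real n * \<sigma>\<^sup>2 + real l * E) / (2 * s\<^sup>2) = real n / 2"
  proof -
    have "real n * \<sigma>\<^sup>2 + real l * E = real n * s\<^sup>2" using n by (simp add: s2 \<sigma>2 field_simps)
    then show ?thesis using s by simp
  qed
  also have "A = real n / 2 * ln (1 + 2 * real l * E / (real n * N0)) + real l * ln 2"
  proof -
    have "1 + 2 * real l * E / (real n * N0) = (s / \<sigma>)\<^sup>2"
      using n N0 by (simp add: power_divide s2 \<sigma>2 field_simps)
    then have "ln (1 + 2 * real l * E / (real n * N0)) = 2 * ln (s / \<sigma>)"
      using s \<sigma> by (simp add: ln_realpow)
    then show ?thesis by (simp add: A_def c_def)
  qed
  finally have upper: "(\<integral>W. ln (real M) * (\<Sum>i<l. G W i) \<partial>P) \<le>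
      real n / 2 * ln (1 + 2 * real l * E / (real n * N0)) + real n / 2 + real l * ln 2 + 1" by simp
  have "real l * (\<alpha> - avg_error_prob N0 \<alpha> l n M x g) = (\<Sum>i<l. \<alpha> - user_error_prob N0 \<alpha> l n M x g i)"
    using l by (simp add: avg_error_prob_def sum_subtractf field_simps)
  also have "\<dots> \<le> (\<Sum>i<l. \<integral>W. G W i \<partial>P)"
    using err by (intro sum_mono) auto
  finally have "real l * (\<alpha> - avg_error_prob N0 \<alpha> l n M x g) * ln (real M) \<le> (\<Sum>i<l. \<integral>W. G W i \<partial>P) * ln (real M)"
    using lnM by (rule mult_right_mono)
  also have "\<dots> = (\<integral>W. ln (real M) * (\<Sum>i<l. G W i) \<partial>P)"
    by (simp add: intP mult.commute)
  finally show ?thesis using upper by linarith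
qed

section \<open>Upper bounds on achievable rates\<close>

lemma liminf_pos_eventually_gt:
  assumes "liminf (\<lambda>n. ereal (f n)) > 0"
  obtains a where "0 < a" "\<forall>\<^sub>F n in sequentially. a < f n"
proof -
  obtain a where a: "0 < ereal a" "ereal a < liminf (\<lambda>n. ereal (f n))"
    using ereal_dense2[OF assms] by blast
  from less_LiminfD[OF a(2)] have "\<forall>\<^sub>F n in sequentially. a < f n" by simp
  with a(1) that show thesis by simp
qed

text \<open>A contradiction needs only one sufficiently large blocklength; \<open>P\<close> carries
  the asymptotic properties of \<open>\<alpha>\<close> and \<open>l\<close> to it.\<close>

lemma achievable_obtains_code:
  assumes "achievable N0 \<alpha> l R" "0 < \<epsilon>" "\<epsilon> < 1" "R' < R" "\<forall>\<^sub>F n in sequentially. P n"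
  obtains n M E x g where "P n" "1 \<le> n" "APE_code N0 (\<alpha> n) (l n) n M E \<epsilon> x g"
    "R' < log 2 (real M) / E"
proof -
  have "eps_achievable N0 \<alpha> l \<epsilon> R" using assms by (simp add: achievable_def)
  then obtain n0 where n0: "\<And>n. n \<ge> n0 \<Longrightarrow> \<exists>M E x g. APE_code N0 (\<alpha> n) (l n) n M E \<epsilon> x g \<and>
      log 2 (real M) / E > R - (R - R')"
    using assms(4) unfolding eps_achievable_def by (metis diff_gt_0_iff_gt)
  obtain n1 where n1: "\<And>n. n \<ge> n1 \<Longrightarrow> P n"
    using assms(5) by (auto simp: eventually_sequentially)
  define n where "n = max 1 (max n0 n1)"
  have "P n" "1 \<le> n" "n0 \<le> n" using n1 by (auto simp: n_def)
  then show thesis using n0[of n] that[of n] by auto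
qed

lemma APE_code_ln_rate:
  assumes "APE_code N0 \<alpha> l n M E \<epsilon> x g" "R < log 2 (real M) / E"
  shows "R * ln 2 * E < ln (real M)"
proof -
  have "0 < E" using assms by (simp add: APE_code_def)
  then show ?thesis using assms(2) by (simp add: log_def field_simps)
qed

text \<open>The error floor of an active user at energy \<open>E\<close>, from the cyclic comparison
  of codewords; it gets a name because \<open>\<epsilon>\<close> is chosen below it.\<close>

definition low_energy_error :: "real \<Rightarrow> real \<Rightarrow> real" where
  "low_energy_error N0 E = (3/4) / (1 + exp (8 * E / N0 + ln 4))"

lemma low_energy_error_pos: "0 < low_energy_error N0 E"
  by (simp add: low_energy_error_def add_pos_pos)

lemma low_energy_error_antimono: "0 < N0 \<Longrightarrow> E \<le> E' \<Longrightarrow> low_energy_error N0 E' \<le> low_energy_error N0 E"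
  unfolding low_energy_error_def by (intro divide_left_mono) (auto intro!: divide_right_mono mult_pos_pos add_pos_pos)

text \<open>Contrapositive of \<open>APE_code_low_energy_error\<close>, with monotonicity in the
  energy. The threshold refers to \<open>a\<close> instead of \<open>\<alpha>\<close>, so that
  \<open>\<epsilon>\<close> can be chosen before the blocklength.\<close>

lemma APE_code_small_error_energy:
  assumes code: "APE_code N0 \<alpha> l n M E \<epsilon> x g" and N0: "0 < N0" and l: "1 \<le> l"
    and \<alpha>: "0 < a" "a \<le> \<alpha>" "\<alpha> \<le> 1" and M: "2 \<le> M" and \<epsilon>: "\<epsilon> < a * low_energy_error N0 E0"
  shows "E0 < E"
proof (rule ccontr)
  assume "\<not> E0 < E"
  then have "low_energy_error N0 E0 \<le> low_energy_error N0 E"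
    using N0 by (intro low_energy_error_antimono) auto
  then have "a * low_energy_error N0 E0 \<le> \<alpha> * low_energy_error N0 E"
    using \<alpha> less_imp_le[OF low_energy_error_pos] by (intro mult_mono) auto
  also have "\<dots> \<le> avg_error_prob N0 \<alpha> l n M x g"
    using APE_code_low_energy_error[OF code N0 l _ _ M] \<alpha> by (simp add: low_energy_error_def)
  also have "\<dots> \<le> \<epsilon>" using code by (simp add: APE_code_def)
  finally show False using \<epsilon> by simp
qed

lemma achievable_le:
  assumes N0: "0 < N0" and l: "\<And>n. n \<ge> 1 \<Longrightarrow> l n \<ge> 1"
    and \<alpha>: "\<And>n. n \<ge> 1 \<Longrightarrow> 0 < \<alpha> n \<and> \<alpha> n \<le> 1"
    and inf: "liminf (\<lambda>n. ereal (\<alpha> n)) > 0"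
    and R: "achievable N0 \<alpha> l R"
  shows "R \<le> 1 / (N0 * ln 2)"
proof (rule ccontr)
  assume "\<not> R \<le> 1 / (N0 * ln 2)"
  then have big: "1 < R * N0 * ln 2" using N0 by (simp add: field_simps)
  \<comment> \<open>The margin \<open>6 * d\<close> of \<open>R * N0 * ln 2\<close> over 1 is split:
    \<open>R'\<close> keeps \<open>3 * d\<close>, the threshold \<open>\<gamma>\<close> below keeps
    \<open>2 * d\<close>, and the tilt is \<open>s = d\<close>. Then \<open>ln M - \<gamma>\<close>
    exceeds \<open>d * (E / N0)\<close>, and the tilt exponent equals
    \<open>- (d\<^sup>2 * (E / N0))\<close>.\<close>
  define d where "d = (R * N0 * ln 2 - 1) / 6"
  have d: "0 < d" using big by (simp add: d_def)
  define R' where "R' = (1 + 3 * d) / (N0 * ln 2)"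
  have R': "R' < R" using big N0 by (simp add: R'_def d_def field_simps)
  obtain a where a: "0 < a" "\<forall>\<^sub>F n in sequentially. a < \<alpha> n"
    using liminf_pos_eventually_gt[OF inf] .
  \<comment> \<open>Once \<open>q * (E / N0)\<close> reaches \<open>ln 4\<close>, both terms
    subtracted in \<open>APE_code_error_ge\<close> are at most 1/4; \<open>E0\<close> is the energy
    at which this happens.\<close>
  define q where "q = min d (d\<^sup>2)"
  have q: "0 < q" "q \<le> d" "q \<le> d\<^sup>2" using d by (auto simp: q_def)
  define E0 where "E0 = N0 * ln 4 / q"
  define \<epsilon> where "\<epsilon> = min (1/2) (min (a / 4) (a * low_energy_error N0 E0 / 2))"
  have \<epsilon>: "0 < \<epsilon>" "\<epsilon> < 1" "\<epsilon> < a / 2" "\<epsilon> < a * low_energy_error N0 E0"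
    using a low_energy_error_pos[of N0 E0] by (auto simp: \<epsilon>_def min_less_iff_disj)
  obtain n M E x g where *: "a < \<alpha> n" "1 \<le> n" and code: "APE_code N0 (\<alpha> n) (l n) n M E \<epsilon> x g"
    and "R' < log 2 (real M) / E"
    using achievable_obtains_code[OF R \<epsilon>(1,2) R' a(2)] .
  then have rate: "R' * ln 2 * E < ln (real M)" using APE_code_ln_rate by blast
  have E: "0 < E" and avg: "avg_error_prob N0 (\<alpha> n) (l n) n M x g \<le> \<epsilon>" and M1: "1 \<le> M"
    using code by (auto simp: APE_code_def)
  have rate': "(1 + 3 * d) * (E / N0) < ln (real M)"
    using rate N0 by (simp add: R'_def)
  have "0 < (1 + 3 * d) * (E / N0)" using d E N0 by (intro mult_pos_pos) auto
  then have "0 < ln (real M)" using rate' by linarith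
  then have M: "2 \<le> M" using M1 by (cases "M = 1") auto
  have \<alpha>n: "0 < \<alpha> n" "\<alpha> n \<le> 1" and ln: "1 \<le> l n" using \<alpha> l * by auto
  have "E0 < E"
    using APE_code_small_error_energy[OF code N0 ln a(1) _ \<alpha>n(2) M \<epsilon>(4)] * by simp
  then have qE: "ln 4 \<le> q * (E / N0)"
    using N0 q by (simp add: E0_def field_simps)
  define \<gamma> where "\<gamma> = (1 + 2 * d) * (E / N0)"
  have EN: "0 \<le> E / N0" using E N0 by simp
  have dE: "ln 4 \<le> d * (E / N0)" "ln 4 \<le> d\<^sup>2 * (E / N0)"
    using qE mult_right_mono[OF q(2) EN] mult_right_mono[OF q(3) EN] by linarith+
  have "exp \<gamma> / real M = exp (\<gamma> - ln (real M))" using M by (simp add: exp_diff)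
  also have "\<dots> \<le> exp (- ln 4)"
  proof (rule exp_mono)
    have "\<gamma> + d * (E / N0) = (1 + 3 * d) * (E / N0)" by (simp add: \<gamma>_def algebra_simps)
    then show "\<gamma> - ln (real M) \<le> - ln 4" using rate' dE(1) by linarith
  qed
  finally have t1: "exp \<gamma> / real M \<le> 1 / 4" by (simp add: exp_minus)
  have "d * (1 + d) * (E / N0) - d * \<gamma> = - (d\<^sup>2 * (E / N0))"
    by (simp add: \<gamma>_def power2_eq_square algebra_simps)
  then have "exp (d * (1 + d) * (E / N0) - d * \<gamma>) \<le> exp (- ln 4)"
    using dE(2) by (intro exp_mono) linarith
  then have t2: "exp (d * (1 + d) * (E / N0) - d * \<gamma>) \<le> 1 / 4" by (simp add: exp_minus)
  have "a / 2 \<le> \<alpha> n * (1 - exp \<gamma> / real M - exp (d * (1 + d) * (E / N0) - d * \<gamma>))"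
  proof -
    have "a * (1 / 2) \<le> \<alpha> n * (1 - exp \<gamma> / real M - exp (d * (1 + d) * (E / N0) - d * \<gamma>))"
      using *(1) a(1) t1 t2 by (intro mult_mono) auto
    then show ?thesis by simp
  qed
  also have "\<dots> \<le> avg_error_prob N0 (\<alpha> n) (l n) n M x g"
    using t1 t2 d by (intro APE_code_error_ge[OF code N0 ln \<alpha>n]) auto
  finally show False using avg \<epsilon>(3) by simp
qed

section \<open>Many users: the energy stays bounded\<close>

lemma ln_one_plus_le_sqrt:
  assumes "0 \<le> y"
  shows "ln (1 + y) \<le> 2 * sqrt y"
proof -
  have "1 + y \<le> (1 + sqrt y)\<^sup>2" using assms by (simp add: power2_eq_square algebra_simps)
  then have "ln (1 + y) \<le> ln ((1 + sqrt y)\<^sup>2)" using assms by (simp add: ln_mono)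
  also have "\<dots> = 2 * ln (1 + sqrt y)" using assms by (simp add: ln_realpow add_pos_nonneg)
  also have "ln (1 + sqrt y) \<le> sqrt y" using ln_add_one_self_le_self[of "sqrt y"] assms by simp
  finally show ?thesis by simp
qed

text \<open>Completing the square absorbs \<open>B * sqrt E\<close> into half of
  \<open>b * E\<close>.\<close>

lemma energy_bound_of_sqrt_bound:
  fixes E :: real
  assumes "0 \<le> E" "0 < b" "b * E \<le> B * sqrt E + C"
  shows "E \<le> 2 / b * (C + B\<^sup>2 / (2 * b))"
proof -
  have "0 \<le> (b * sqrt E - B)\<^sup>2" by simp
  then have "2 * b * (B * sqrt E) \<le> b\<^sup>2 * E + B\<^sup>2"
    using assms(1) by (simp add: power2_diff power_mult_distrib algebra_simps)
  then have "B * sqrt E \<le> b * E / 2 + B\<^sup>2 / (2 * b)"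
    using assms(2) by (simp add: field_simps power2_eq_square)
  then have "b * E / 2 \<le> C + B\<^sup>2 / (2 * b)" using assms(3) by linarith
  then have "2 / b * (b * E / 2) \<le> 2 / b * (C + B\<^sup>2 / (2 * b))"
    using assms(2) by (intro mult_left_mono) auto
  then show ?thesis using assms(2) by simp
qed

lemma achievable_nonpos:
  assumes N0: "0 < N0" and l: "\<And>n. n \<ge> 1 \<Longrightarrow> l n \<ge> 1"
    and \<alpha>: "\<And>n. n \<ge> 1 \<Longrightarrow> 0 < \<alpha> n \<and> \<alpha> n \<le> 1"
    and inf: "liminf (\<lambda>n. ereal (\<alpha> n)) > 0"
    and many: "liminf (\<lambda>n. ereal (real (l n) / real n)) > 0"
    and R: "achievable N0 \<alpha> l R"
  shows "R \<le> 0"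
proof (rule ccontr)
  assume "\<not> R \<le> 0"
  then have R0: "0 < R" by simp
  obtain a where a: "0 < a" "\<forall>\<^sub>F n in sequentially. a < \<alpha> n"
    using liminf_pos_eventually_gt[OF inf] .
  obtain c where c: "0 < c" "\<forall>\<^sub>F n in sequentially. c < real (l n) / real n"
    using liminf_pos_eventually_gt[OF many] .
  define r where "r = R / 2 * ln 2"
  have r: "0 < r" using R0 by (simp add: r_def)
  \<comment> \<open>\<open>B\<close>, \<open>C\<close> and \<open>b\<close> anticipate the
    inequality \<open>b * E \<le> B * sqrt E + C\<close> derived below from the sum-rate bound;
    \<open>E0\<close> is the energy bound that follows from it.\<close>
  define B where "B = sqrt (2 / (c * N0))"
  define C where "C = 1 / (2 * c) + ln 2 + 1"
  define b where "b = a / 2 * r"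
  have b: "0 < b" using a r by (simp add: b_def)
  define E0 where "E0 = 2 / b * (C + B\<^sup>2 / (2 * b))"
  define \<epsilon> where "\<epsilon> = min (1/2) (min (a / 2) (a * low_energy_error N0 E0 / 2))"
  have \<epsilon>: "0 < \<epsilon>" "\<epsilon> < 1" "\<epsilon> \<le> a / 2" "\<epsilon> < a * low_energy_error N0 E0"
    using a low_energy_error_pos[of N0 E0] by (auto simp: \<epsilon>_def min_less_iff_disj)
  have R': "R / 2 < R" using R0 by simp
  obtain n M E x g where *: "a < \<alpha> n \<and> c < real (l n) / real n" "1 \<le> n"
    and code: "APE_code N0 (\<alpha> n) (l n) n M E \<epsilon> x g" and "R / 2 < log 2 (real M) / E"
    using achievable_obtains_code[OF R \<epsilon>(1,2) R' eventually_conj[OF a(2) c(2)]] .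
  then have rate: "r * E < ln (real M)" using APE_code_ln_rate unfolding r_def by blast
  have E: "0 < E" and avg: "avg_error_prob N0 (\<alpha> n) (l n) n M x g \<le> \<epsilon>" and M1: "1 \<le> M"
    using code by (auto simp: APE_code_def)
  have lnM: "0 < ln (real M)" using rate mult_pos_pos[OF r E] by linarith
  then have M: "2 \<le> M" using M1 by (cases "M = 1") auto
  have \<alpha>n: "0 < \<alpha> n" "\<alpha> n \<le> 1" and ln: "1 \<le> l n" using \<alpha> l * by auto
  define t where "t = real (l n) / real n"
  have t: "c < t" "0 < t" using * c by (auto simp: t_def)
  have ln_t: "real (l n) = t * real n" using * by (simp add: t_def)
  have y: "2 * real (l n) * E / (real n * N0) = 2 * t * E / N0"
    using * by (simp add: t_def)
  have n_t: "real n = real (l n) / t" using ln_t t by simp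
  have "real (l n) * (a / 2) * ln (real M) \<le> real (l n) * (\<alpha> n - avg_error_prob N0 (\<alpha> n) (l n) n M x g) * ln (real M)"
    using * avg \<epsilon>(3) lnM by (intro mult_right_mono mult_left_mono) auto
  also have "\<dots> \<le> real n / 2 * ln (1 + 2 * t * E / N0) + real n / 2 + real (l n) * ln 2 + 1"
    using APE_code_sum_rate[OF code N0 *(2) ln \<alpha>n] unfolding y .
  also have "\<dots> \<le> real n / 2 * ln (1 + 2 * t * E / N0) + real n / 2 + real (l n) * ln 2 + real (l n)"
    using ln by simp
  also have "\<dots> = real (l n) * (1 / (2 * t) * ln (1 + 2 * t * E / N0) + 1 / (2 * t) + ln 2 + 1)"
    unfolding n_t by (simp add: algebra_simps)
  finally have "a / 2 * ln (real M) \<le> 1 / (2 * t) * ln (1 + 2 * t * E / N0) + 1 / (2 * t) + ln 2 + 1"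
    using ln by (simp add: mult.assoc)
  also have "1 / (2 * t) * ln (1 + 2 * t * E / N0) \<le> 1 / (2 * t) * (2 * sqrt (2 * t * E / N0))"
    using t E N0 by (intro mult_left_mono ln_one_plus_le_sqrt) auto
  also have "1 / (2 * t) * (2 * sqrt (2 * t * E / N0)) = sqrt (2 / (t * N0)) * sqrt E"
  proof -
    have "sqrt (2 * t * E / N0) = sqrt (t\<^sup>2 * (2 / (t * N0) * E))"
      using t by (simp add: power2_eq_square)
    also have "\<dots> = t * sqrt (2 / (t * N0)) * sqrt E"
      using t by (simp only: real_sqrt_mult real_sqrt_abs abs_of_pos mult.assoc)
    finally show ?thesis using t by simp
  qed
  \<comment> \<open>The coefficient decreases in \<open>t\<close>, so \<open>t\<close> may be
    replaced by its lower bound \<open>c\<close>, however fast \<open>l n / n\<close> grows.\<close>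
  also have "sqrt (2 / (t * N0)) * sqrt E \<le> B * sqrt E"
    unfolding B_def using t c N0 E by (intro mult_right_mono real_sqrt_le_mono divide_left_mono) auto
  also have "1 / (2 * t) \<le> 1 / (2 * c)"
    using t c by (intro divide_left_mono) auto
  finally have "a / 2 * ln (real M) \<le> B * sqrt E + C" by (simp add: C_def)
  moreover have "b * E \<le> a / 2 * ln (real M)"
    using rate a by (simp add: b_def)
  ultimately have "E \<le> E0"
    unfolding E0_def using E b by (intro energy_bound_of_sqrt_bound) auto
  moreover have "E0 < E"
    using APE_code_small_error_energy[OF code N0 ln a(1) _ \<alpha>n(2) M \<epsilon>(4)] * by simp
  ultimately show False by simp
qed

section \<open>Code constructions\<close>

text \<open>A bound valid for every fixed message vector survives averaging over messages and users,
  so a construction only has to control the worst case.\<close>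

lemma APE_code_intro:
  assumes N0: "0 < N0" and l: "1 \<le> l" and \<alpha>: "0 < \<alpha>" "\<alpha> \<le> 1" and M: "1 \<le> M" and E: "0 < E"
    and zero: "\<And>i j. i < l \<Longrightarrow> j < n \<Longrightarrow> x i 0 j = 0"
    and energy: "\<And>i w. i < l \<Longrightarrow> w \<le> M \<Longrightarrow> (\<Sum>j<n. (x i w j)\<^sup>2) \<le> E"
    and g: "g \<in> (\<Pi>\<^sub>M j\<in>{..<n}. borel) \<rightarrow>\<^sub>M (\<Pi>\<^sub>M i\<in>{..<l}. count_space {0..M})"
    and err: "\<And>W i. (\<And>k. W k \<le> M) \<Longrightarrow> i < l \<Longrightarrow> measure (gauss n (codeword_sum l x W) (sqrt (N0 / 2)))
      {y \<in> space (\<Pi>\<^sub>M j\<in>{..<n}. borel). g y i \<noteq> W i} \<le> \<epsilon>"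
  shows "APE_code N0 \<alpha> l n M E \<epsilon> x g"
proof -
  \<comment> \<open>Taking its own error probability as tolerance makes this a code, so that
    \<open>user_error_prob_eq\<close> applies before the error is bounded.\<close>
  have code: "APE_code N0 \<alpha> l n M E (avg_error_prob N0 \<alpha> l n M x g) x g"
    using M E zero energy g by (simp add: APE_code_def)
  have fin: "finite (set_pmf (messages_pmf \<alpha> M l))"
    using \<alpha> M by (intro finite_set_messages_pmf) auto
  have "user_error_prob N0 \<alpha> l n M x g i \<le> \<epsilon>" if i: "i < l" for i
  proof -
    have "AE W in messages_pmf \<alpha> M l. measure (gauss n (codeword_sum l x W) (sqrt (N0 / 2)))
        {y \<in> space (\<Pi>\<^sub>M j\<in>{..<n}. borel). g y i \<noteq> W i} \<le> \<epsilon>"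
    proof (rule AE_pmfI)
      fix W assume "W \<in> set_pmf (messages_pmf \<alpha> M l)"
      then have "W k \<le> M" for k using \<alpha> M by (intro set_messages_pmf[of \<alpha> M W l k]) auto
      then show "measure (gauss n (codeword_sum l x W) (sqrt (N0 / 2)))
          {y \<in> space (\<Pi>\<^sub>M j\<in>{..<n}. borel). g y i \<noteq> W i} \<le> \<epsilon>" using i by (rule err)
    qed
    then have "user_error_prob N0 \<alpha> l n M x g i \<le> (\<integral>W. \<epsilon> \<partial>messages_pmf \<alpha> M l)"
      unfolding user_error_prob_eq[OF code N0 i]
      by (intro integral_mono_AE integrable_measure_pmf_finite fin)
    then show ?thesis by simp
  qed
  then have "(\<Sum>i<l. user_error_prob N0 \<alpha> l n M x g i) \<le> (\<Sum>i<l. \<epsilon>)"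
    by (intro sum_mono) auto
  then have "avg_error_prob N0 \<alpha> l n M x g \<le> \<epsilon>"
    using l by (simp add: avg_error_prob_def field_simps)
  then show ?thesis using code by (simp add: APE_code_def)
qed

text \<open>Every user owns a block of \<open>M\<close> coordinates and sends message \<open>w > 0\<close> as a pulse in the
  \<open>w\<close>-th coordinate of its block; the receiver compares each coordinate with the threshold \<open>\<tau>\<close>.\<close>

lemma pulse_position_code:
  assumes N0: "0 < N0" and l: "1 \<le> l" and \<alpha>: "0 < \<alpha>" "\<alpha> \<le> 1" and M: "1 \<le> M" and n: "l * M \<le> n"
    and \<tau>: "0 \<le> \<tau>" "\<tau> \<le> A" and A: "0 < A"
  shows "\<exists>x g. APE_code N0 \<alpha> l n M (A\<^sup>2) (real M * exp (- \<tau>\<^sup>2 / N0) + exp (- (A - \<tau>)\<^sup>2 / N0)) x g"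
proof -
  define \<sigma> where "\<sigma> = sqrt (N0 / 2)"
  have \<sigma>: "0 < \<sigma>" and \<sigma>2: "2 * \<sigma>\<^sup>2 = N0" using N0 by (simp_all add: \<sigma>_def)
  \<comment> \<open>Coordinates start at 0 and active messages at 1, hence the offset
    \<open>w - 1\<close>: block \<open>i\<close> is
    \<open>i * M, ..., i * M + M - 1\<close>.\<close>
  define x :: "nat \<Rightarrow> nat \<Rightarrow> nat \<Rightarrow> real"
    where "x i w j = (if w \<noteq> 0 \<and> j = i * M + (w - 1) then A else 0)" for i w j
  define Q where "Q y i w \<longleftrightarrow> w \<in> {1..M} \<and> \<tau> < y (i * M + (w - 1))" for y :: "nat \<Rightarrow> real" and i w
  \<comment> \<open>The first coordinate of the block above the threshold decides; if there is none,
    the user is declared inactive.\<close>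
  define g :: "(nat \<Rightarrow> real) \<Rightarrow> nat \<Rightarrow> nat"
    where "g y = (\<lambda>i\<in>{..<l}. if \<exists>w. Q y i w then LEAST w. Q y i w else 0)" for y
  define B :: "(nat \<Rightarrow> real) measure" where "B = (\<Pi>\<^sub>M j\<in>{..<n}. borel)"
  have idx: "i * M + (w - 1) < n" if "i < l" "w \<in> {1..M}" for i w
  proof -
    have "i * M + (w - 1) < Suc i * M" using that by auto
    also have "\<dots> \<le> l * M" using that by (intro mult_right_mono) auto
    finally show ?thesis using n by simp
  qed
  have sums: "codeword_sum l x W (i * M + (w - 1)) = (if W i = w then A else 0)"
    if W: "\<And>k. W k \<le> M" and i: "i < l" and w: "w \<in> {1..M}" for W i w
  proof -
    have "x k (W k) (i * M + (w - 1)) = (if k = i then (if W i = w then A else 0) else 0)" for k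
    proof (cases "W k = 0")
      case True
      then show ?thesis using w by (auto simp: x_def)
    next
      case False
      \<comment> \<open>Quotient and remainder modulo \<open>M\<close> recover user and message from
        the coordinate, so pulses of different users never overlap.\<close>
      have "k = i \<and> W k = w" if eq: "i * M + (w - 1) = k * M + (W k - 1)"
      proof -
        have lt: "w - 1 < M" "W k - 1 < M" using w W[of k] False M by auto
        have "(i * M + (w - 1)) div M = i" "(k * M + (W k - 1)) div M = k"
          using lt by simp_all
        with eq have "i = k" by metis
        then show ?thesis using eq w False by auto
      qed
      then have "i * M + (w - 1) = k * M + (W k - 1) \<longleftrightarrow> k = i \<and> W k = w" by auto
      then show ?thesis using False by (simp add: x_def)
    qed
    then show ?thesis using i by simp
  qed
  have Qm: "Measurable.pred B (\<lambda>y. Q y i w)" if "i < l" for i w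
  proof (cases "w \<in> {1..M}")
    case True
    have "Measurable.pred B (\<lambda>y. \<tau> < y (i * M + (w - 1)))"
      unfolding B_def by (intro borel_measurable_pred_less coordinate_measurable idx that True) simp
    moreover have "(\<lambda>y. Q y i w) = (\<lambda>y. \<tau> < y (i * M + (w - 1)))" using True by (simp only: Q_def simp_thms)
    ultimately show ?thesis by (simp only:)
  next
    case False
    then have "(\<lambda>y. Q y i w) = (\<lambda>y. False)" by (simp only: Q_def simp_thms)
    then show ?thesis by (simp add: pred_def)
  qed
  have gm: "g \<in> B \<rightarrow>\<^sub>M (\<Pi>\<^sub>M i\<in>{..<l}. count_space {0..M})"
    unfolding g_def
  proof (rule measurable_restrict)
    fix i assume "i \<in> {..<l}"
    then have [measurable]: "Measurable.pred B (\<lambda>y. Q y i w)" for w using Qm by simp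
    have "(\<lambda>y. if \<exists>w. Q y i w then LEAST w. Q y i w else 0) \<in> B \<rightarrow>\<^sub>M count_space UNIV"
      by measurable
    moreover have "(if \<exists>w. Q y i w then LEAST w. Q y i w else 0) \<in> {0..M}" for y
      using LeastI_ex[of "Q y i"] by (auto simp: Q_def)
    ultimately show "(\<lambda>y. if \<exists>w. Q y i w then LEAST w. Q y i w else 0) \<in> B \<rightarrow>\<^sub>M count_space {0..M}"
      by (subst measurable_count_space_eq2) (auto simp: measurable_def)
  qed
  have "APE_code N0 \<alpha> l n M (A\<^sup>2) (real M * exp (- \<tau>\<^sup>2 / N0) + exp (- (A - \<tau>)\<^sup>2 / N0)) x g"
  proof (rule APE_code_intro[OF N0 l \<alpha> M])
    show "0 < A\<^sup>2" using A by simp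
    show "x i 0 j = 0" for i j by (simp add: x_def)
    show "(\<Sum>j<n. (x i w j)\<^sup>2) \<le> A\<^sup>2" if "i < l" "w \<le> M" for i w
    proof (cases "w = 0")
      case True
      then show ?thesis by (simp add: x_def)
    next
      case False
      have "(\<Sum>j<n. (x i w j)\<^sup>2) = (\<Sum>j<n. if j = i * M + (w - 1) then A\<^sup>2 else 0)"
        using False by (intro sum.cong) (auto simp: x_def)
      then show ?thesis by simp
    qed
    show "g \<in> (\<Pi>\<^sub>M j\<in>{..<n}. borel) \<rightarrow>\<^sub>M (\<Pi>\<^sub>M i\<in>{..<l}. count_space {0..M})"
      using gm by (simp add: B_def)
  next
    fix W :: "nat \<Rightarrow> nat" and i assume W: "\<And>k. W k \<le> M" and i: "i < l"
    define G where "G = gauss n (codeword_sum l x W) \<sigma>"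
    interpret G: prob_space G unfolding G_def by (rule prob_space_gauss[OF \<sigma>])
    have spG: "space G = space B" by (simp add: G_def B_def space_gauss)
    define T where "T w = {y \<in> space G. \<tau> \<le> y (i * M + (w - 1))}" for w
    define U where "U = {y \<in> space G. W i \<noteq> 0 \<and> y (i * M + (W i - 1)) \<le> \<tau>}"
    have T: "T w \<in> sets G" if "w \<in> {1..M}" for w
      unfolding T_def G_def by (intro borel_measurable_le gauss_coordinate_measurable idx i that) simp
    have U: "U \<in> sets G"
    proof (cases "W i = 0")
      case True
      then show ?thesis by (simp add: U_def)
    next
      case False
      then have w: "W i \<in> {1..M}" using W[of i] by auto
      have "{y \<in> space G. y (i * M + (W i - 1)) \<le> \<tau>} \<in> sets G"
        unfolding G_def
        by (intro borel_measurable_le gauss_coordinate_measurable borel_measurable_const idx i w)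
      then show ?thesis using False by (simp add: U_def)
    qed
    have probT: "G.prob (T w) \<le> exp (- \<tau>\<^sup>2 / N0)" if "w \<in> {1..M} - {W i}" for w
    proof -
      have w: "w \<in> {1..M}" "W i \<noteq> w" using that by auto
      have c: "codeword_sum l x W (i * M + (w - 1)) = 0" using sums[OF W i w(1)] w(2) by simp
      show ?thesis
        using gauss_upper_tail[OF \<sigma> idx[OF i w(1)], of "codeword_sum l x W" \<tau>] \<tau>(1)
        unfolding c \<sigma>2 T_def G_def by simp
    qed
    have sumT: "(\<Sum>w\<in>{1..M} - {W i}. G.prob (T w)) \<le> real M * exp (- \<tau>\<^sup>2 / N0)"
    proof -
      have "(\<Sum>w\<in>{1..M} - {W i}. G.prob (T w)) \<le> real (card ({1..M} - {W i})) * exp (- \<tau>\<^sup>2 / N0)"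
        by (rule sum_bounded_above[OF probT])
      also have "\<dots> \<le> real M * exp (- \<tau>\<^sup>2 / N0)"
        using card_Diff1_le[of "{1..M}" "W i"] by (intro mult_right_mono) auto
      finally show ?thesis .
    qed
    have probU: "G.prob U \<le> exp (- (A - \<tau>)\<^sup>2 / N0)"
    proof (cases "W i = 0")
      case True
      then show ?thesis by (simp add: U_def)
    next
      case False
      then have w: "W i \<in> {1..M}" using W[of i] by auto
      have c: "codeword_sum l x W (i * M + (W i - 1)) = A" using sums[OF W i w] by simp
      show ?thesis
        using gauss_lower_tail[OF \<sigma> idx[OF i w], of \<tau> "codeword_sum l x W"] \<tau>(2) False
        unfolding c \<sigma>2 U_def G_def by simp
    qed
    \<comment> \<open>A nonzero decision always names a coordinate above the threshold, so an error
      requires a false crossing (\<open>T\<close>) or a missed pulse (\<open>U\<close>).\<close>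
    have sub: "{y \<in> space B. g y i \<noteq> W i} \<subseteq> (\<Union>w\<in>{1..M} - {W i}. T w) \<union> U"
    proof
      fix y assume "y \<in> {y \<in> space B. g y i \<noteq> W i}"
      then have y: "y \<in> space G" "g y i \<noteq> W i" by (auto simp: spG)
      show "y \<in> (\<Union>w\<in>{1..M} - {W i}. T w) \<union> U"
      proof (cases "\<exists>w. Q y i w")
        case True
        then have "g y i = (LEAST w. Q y i w)" using i by (simp add: g_def)
        then have "Q y i (g y i)" using LeastI_ex[OF True] by simp
        then have "g y i \<in> {1..M} - {W i}" "y \<in> T (g y i)" using y by (auto simp: Q_def T_def)
        then show ?thesis by blast
      next
        case False
        then have "g y i = 0" using i by (auto simp: g_def)
        then have "W i \<noteq> 0" using y by simp
        moreover have "\<not> Q y i (W i)" using False by blast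
        ultimately have "y \<in> U" using y W[of i] by (auto simp: Q_def U_def)
        then show ?thesis ..
      qed
    qed
    have "G.prob {y \<in> space B. g y i \<noteq> W i} \<le> G.prob ((\<Union>w\<in>{1..M} - {W i}. T w) \<union> U)"
      using T U by (intro G.finite_measure_mono sub) auto
    also have "\<dots> \<le> G.prob (\<Union>w\<in>{1..M} - {W i}. T w) + G.prob U"
      using T U by (intro measure_Un_le) auto
    also have "G.prob (\<Union>w\<in>{1..M} - {W i}. T w) \<le> (\<Sum>w\<in>{1..M} - {W i}. G.prob (T w))"
      using T by (intro G.finite_measure_subadditive_finite) auto
    also have "\<dots> \<le> real M * exp (- \<tau>\<^sup>2 / N0)" by (rule sumT)
    also note probU
    finally show "measure (gauss n (codeword_sum l x W) (sqrt (N0 / 2)))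
        {y \<in> space (\<Pi>\<^sub>M j\<in>{..<n}. borel). g y i \<noteq> W i} \<le>
        real M * exp (- \<tau>\<^sup>2 / N0) + exp (- (A - \<tau>)\<^sup>2 / N0)"
      by (simp add: G_def B_def \<sigma>_def)
  qed
  then show ?thesis by blast
qed

text \<open>Induction on the number of digits: the new top digit is either the requested one, and
  the lower digits sum to less than \<open>2 ^ l\<close>, or it contributes an even number after
  division by \<open>2 ^ k\<close>.\<close>

lemma binary_digit_of_sum:
  assumes "\<And>i. b i \<le> (1::nat)" "k < l"
  shows "(\<Sum>i<l. b i * 2 ^ i) div 2 ^ k mod 2 = b k"
  using assms(2)
proof (induction l)
  case (Suc l)
  have lt: "(\<Sum>i<l. b i * 2 ^ i) < 2 ^ l"
  proof (induction l)
    case (Suc l)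
    have "b l * 2 ^ l \<le> 2 ^ l" using assms(1)[of l] by (cases "b l") auto
    with Suc.IH show ?case by (simp only: sum.lessThan_Suc power_Suc)
  qed simp
  show ?case
  proof (cases "k = l")
    case True
    then show ?thesis using lt assms(1)[of l] by simp
  next
    case False
    then have k: "k < l" using Suc.prems by simp
    have "(\<Sum>i<Suc l. b i * 2 ^ i) = (\<Sum>i<l. b i * 2 ^ i) + b l * 2 ^ (l - k) * 2 ^ k"
      using k by (simp add: mult.assoc flip: power_add)
    moreover have "(S + c * 2 ^ k) div 2 ^ k = c + S div 2 ^ k" for S c :: nat by simp
    ultimately have "(\<Sum>i<Suc l. b i * 2 ^ i) div 2 ^ k = b l * 2 ^ (l - k) + (\<Sum>i<l. b i * 2 ^ i) div 2 ^ k"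
      by (simp only:)
    moreover have "even (b l * 2 ^ (l - k))" using k by simp
    moreover have "even c \<Longrightarrow> (c + S) mod 2 = S mod 2" for S c :: nat by presburger
    ultimately show ?thesis using Suc.IH[OF k] by (simp only:)
  qed
qed simp

text \<open>All users share one coordinate; the messages are the binary digits of the noiseless sum.\<close>

lemma binary_digits_code:
  assumes N0: "0 < N0" and l: "1 \<le> l" and \<alpha>: "0 < \<alpha>" "\<alpha> \<le> 1" and n: "1 \<le> n" and A: "0 < A"
  shows "\<exists>x g. APE_code N0 \<alpha> l n 1 (A\<^sup>2 * 4 ^ l) (2 * exp (- (A / 2)\<^sup>2 / N0)) x g"
proof -
  define \<sigma> where "\<sigma> = sqrt (N0 / 2)"
  have \<sigma>: "0 < \<sigma>" and \<sigma>2: "2 * \<sigma>\<^sup>2 = N0" using N0 by (simp_all add: \<sigma>_def)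
  define x :: "nat \<Rightarrow> nat \<Rightarrow> nat \<Rightarrow> real"
    where "x i w j = (if w = 0 \<or> j \<noteq> 0 then 0 else A * 2 ^ i)" for i w j
  \<comment> \<open>Rounding \<open>y 0 / A\<close> to the nearest integer recovers the noiseless
    sum whenever the noise in coordinate 0 is smaller than \<open>A / 2\<close> in absolute
    value.\<close>
  define g :: "(nat \<Rightarrow> real) \<Rightarrow> nat \<Rightarrow> nat"
    where "g y = (\<lambda>i\<in>{..<l}. nat \<lfloor>y 0 / A + 1/2\<rfloor> div 2 ^ i mod 2)" for y
  have n0: "0 < n" using n by simp
  have gm: "g \<in> (\<Pi>\<^sub>M j\<in>{..<n}. borel) \<rightarrow>\<^sub>M (\<Pi>\<^sub>M i\<in>{..<l}. count_space {0..1})"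
    unfolding g_def
  proof (rule measurable_restrict)
    fix i
    have "(\<lambda>y. y 0 / A + 1/2) \<in> borel_measurable (\<Pi>\<^sub>M j\<in>{..<n}. borel)"
      by (intro borel_measurable_add borel_measurable_divide borel_measurable_const coordinate_measurable n0)
    then have "(\<lambda>y. \<lfloor>y 0 / A + 1/2\<rfloor>) \<in> (\<Pi>\<^sub>M j\<in>{..<n}. borel) \<rightarrow>\<^sub>M count_space UNIV"
      by (rule measurable_compose[OF _ measurable_real_floor])
    then show "(\<lambda>y. nat \<lfloor>y 0 / A + 1/2\<rfloor> div 2 ^ i mod 2) \<in> (\<Pi>\<^sub>M j\<in>{..<n}. borel) \<rightarrow>\<^sub>M count_space {0..1}"
      by (rule measurable_compose) auto
  qed
  have "APE_code N0 \<alpha> l n 1 (A\<^sup>2 * 4 ^ l) (2 * exp (- (A / 2)\<^sup>2 / N0)) x g"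
  proof (rule APE_code_intro[OF N0 l \<alpha>])
    show "0 < A\<^sup>2 * 4 ^ l" using A by simp
    show "x i 0 j = 0" for i j by (simp add: x_def)
    show "(\<Sum>j<n. (x i w j)\<^sup>2) \<le> A\<^sup>2 * 4 ^ l" if "i < l" for i w
    proof -
      have "(\<Sum>j<n. (x i w j)\<^sup>2) \<le> (\<Sum>j<n. if j = 0 then A\<^sup>2 * 4 ^ i else 0)"
        using power_mult[of "2 :: real" i 2] power_mult[of "2 :: real" 2 i]
        by (intro sum_mono) (simp add: x_def power_mult_distrib mult.commute)
      also have "\<dots> = A\<^sup>2 * 4 ^ i" using n0 by simp
      also have "\<dots> \<le> A\<^sup>2 * 4 ^ l" using that by (intro mult_left_mono power_increasing) auto
      finally show ?thesis .
    qed
    show "g \<in> (\<Pi>\<^sub>M j\<in>{..<n}. borel) \<rightarrow>\<^sub>M (\<Pi>\<^sub>M i\<in>{..<l}. count_space {0..1})" by (rule gm)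
  next
    fix W :: "nat \<Rightarrow> nat" and i assume W: "\<And>k. W k \<le> 1" and i: "i < l"
    define c where "c = codeword_sum l x W"
    define G where "G = gauss n c \<sigma>"
    interpret G: prob_space G unfolding G_def by (rule prob_space_gauss[OF \<sigma>])
    define m where "m = (\<Sum>k<l. W k * 2 ^ k)"
    have "x k (W k) 0 = A * real (W k * 2 ^ k)" for k
      using W[of k] by (cases "W k = 0") (auto simp: x_def le_Suc_eq)
    then have c0: "c 0 = A * real m"
      by (simp add: c_def m_def sum_distrib_left)
    define T where "T = {y \<in> space G. c 0 + A / 2 \<le> y 0}"
    define U where "U = {y \<in> space G. y 0 \<le> c 0 - A / 2}"
    have T: "T \<in> sets G" and U: "U \<in> sets G"
      unfolding T_def U_def G_def by (intro borel_measurable_le gauss_coordinate_measurable n0; simp)+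
    have sub: "{y \<in> space G. g y i \<noteq> W i} \<subseteq> T \<union> U"
    proof (rule subsetI, rule ccontr)
      fix y assume y: "y \<in> {y \<in> space G. g y i \<noteq> W i}" "y \<notin> T \<union> U"
      then have "A * real m - A / 2 < y 0" "y 0 < A * real m + A / 2"
        by (auto simp: T_def U_def c0)
      then have "real m \<le> y 0 / A + 1/2" "y 0 / A + 1/2 < real m + 1"
        using A by (simp_all add: field_simps)
      then have "\<lfloor>y 0 / A + 1/2\<rfloor> = int m" by (intro floor_unique) auto
      then have "g y i = m div 2 ^ i mod 2" using i by (simp add: g_def)
      also have "\<dots> = W i" unfolding m_def by (rule binary_digit_of_sum[OF W i])
      finally show False using y by simp
    qed
    have "G.prob {y \<in> space G. g y i \<noteq> W i} \<le> G.prob (T \<union> U)"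
      using T U by (intro G.finite_measure_mono sub) auto
    also have "\<dots> \<le> G.prob T + G.prob U"
      using T U by (intro measure_Un_le) auto
    also have "\<dots> \<le> exp (- (A / 2)\<^sup>2 / N0) + exp (- (A / 2)\<^sup>2 / N0)"
      using gauss_upper_tail[OF \<sigma> n0, of c "c 0 + A / 2"] gauss_lower_tail[OF \<sigma> n0, of "c 0 - A / 2" c] A
      unfolding \<sigma>2 T_def U_def G_def by (intro add_mono) simp_all
    finally show "measure (gauss n (codeword_sum l x W) (sqrt (N0 / 2)))
        {y \<in> space (\<Pi>\<^sub>M j\<in>{..<n}. borel). g y i \<noteq> W i} \<le> 2 * exp (- (A / 2)\<^sup>2 / N0)"
      by (simp add: G_def c_def \<sigma>_def space_gauss)
  qed simp
  then show ?thesis by blast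
qed

section \<open>Rates achieved by the two codes\<close>

lemma achievable_zero:
  assumes N0: "0 < N0" and l: "\<And>n. n \<ge> 1 \<Longrightarrow> l n \<ge> 1"
    and \<alpha>: "\<And>n. n \<ge> 1 \<Longrightarrow> 0 < \<alpha> n \<and> \<alpha> n \<le> 1"
  shows "achievable N0 \<alpha> l 0"
  unfolding achievable_def eps_achievable_def
proof (intro allI impI)
  fix \<epsilon> \<delta> :: real assume \<epsilon>: "0 < \<epsilon> \<and> \<epsilon> < 1" and \<delta>: "0 < \<delta>"
  \<comment> \<open>Solves \<open>2 * exp (- (A / 2)\<^sup>2 / N0) = \<epsilon>\<close>; the
    amplitude depends on neither the blocklength nor the number of users.\<close>
  define A where "A = 2 * sqrt (N0 * ln (2 / \<epsilon>))"
  have "0 < N0 * ln (2 / \<epsilon>)" using N0 \<epsilon> by simp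
  then have A: "0 < A" "(A / 2)\<^sup>2 = N0 * ln (2 / \<epsilon>)" by (simp_all add: A_def)
  have "- (A / 2)\<^sup>2 / N0 = - ln (2 / \<epsilon>)" unfolding A(2) using N0 by simp
  then have err: "2 * exp (- (A / 2)\<^sup>2 / N0) = \<epsilon>"
    using \<epsilon> by (simp add: exp_minus)
  show "\<exists>n0. \<forall>n\<ge>n0. \<exists>M E x g. APE_code N0 (\<alpha> n) (l n) n M E \<epsilon> x g \<and> 0 - \<delta> < log 2 (real M) / E"
  proof (rule exI[of _ 1], intro allI impI)
    fix n :: nat assume n: "1 \<le> n"
    obtain x g where "APE_code N0 (\<alpha> n) (l n) n 1 (A\<^sup>2 * 4 ^ l n) \<epsilon> x g"
      using binary_digits_code[OF N0 l[OF n] _ _ n A(1), of "\<alpha> n"] \<alpha>[OF n] unfolding err by blast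
    moreover have "0 - \<delta> < log 2 (real 1) / (A\<^sup>2 * 4 ^ l n)" using \<delta> by simp
    ultimately show "\<exists>M E x g. APE_code N0 (\<alpha> n) (l n) n M E \<epsilon> x g \<and> 0 - \<delta> < log 2 (real M) / E"
      by blast
  qed
qed

text \<open>The form in which \<open>l = o(n)\<close> is used: the private blocks, and with them the
  number of messages, grow without bound.\<close>

lemma filterlim_div_at_top:
  fixes l :: "nat \<Rightarrow> nat"
  assumes l: "\<And>n. n \<ge> 1 \<Longrightarrow> l n \<ge> 1" and lim: "(\<lambda>n. real (l n) / real n) \<longlonglongrightarrow> 0"
  shows "filterlim (\<lambda>n. n div l n) at_top sequentially"
  unfolding filterlim_at_top
proof
  fix K :: nat
  have "\<forall>\<^sub>F n in sequentially. real (l n) / real n < 1 / real (Suc K)"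
    using lim by (rule order_tendstoD) simp
  then show "\<forall>\<^sub>F n in sequentially. K \<le> n div l n"
    using eventually_ge_at_top[of 1]
  proof eventually_elim
    case (elim n)
    then have "real (Suc K) * real (l n) < real n" by (simp add: field_simps)
    then have "Suc K * l n < n" by (simp only: of_nat_mult[symmetric] of_nat_less_iff)
    then have "K * l n \<le> n" by simp
    then show ?case using l[OF elim(2)] by (simp add: less_eq_div_iff_mult_less_eq)
  qed
qed

lemma achievable_few_users:
  assumes N0: "0 < N0" and l: "\<And>n. n \<ge> 1 \<Longrightarrow> l n \<ge> 1"
    and \<alpha>: "\<And>n. n \<ge> 1 \<Longrightarrow> 0 < \<alpha> n \<and> \<alpha> n \<le> 1"
    and few: "(\<lambda>n. real (l n) / real n) \<longlonglongrightarrow> 0"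
  shows "achievable N0 \<alpha> l (1 / (N0 * ln 2))"
  unfolding achievable_def eps_achievable_def
proof (intro allI impI)
  fix \<epsilon> \<delta> :: real assume \<epsilon>: "0 < \<epsilon> \<and> \<epsilon> < 1" and \<delta>: "0 < \<delta>"
  define M where "M n = n div l n" for n
  \<comment> \<open>\<open>r\<close> is the target rate in nats per unit energy: the pulse energy
    will be \<open>ln M / r\<close>.\<close>
  obtain r where r: "max 0 (1 / N0 - \<delta> * ln 2) < r" "r < 1 / N0"
    using dense[of "max 0 (1 / N0 - \<delta> * ln 2)" "1 / N0"] N0 \<delta> by auto
  then have r0: "0 < r" "N0 < 1 / r" using N0 by (auto simp: field_simps)
  \<comment> \<open>The squared threshold will be \<open>s * ln M\<close>. Since
    \<open>N0 < s\<close>, the union bound over false crossings is \<open>M\<close> to the power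
    \<open>1 - s / N0\<close>, which vanishes; since \<open>s < 1 / r\<close>, the pulse clears the
    threshold by a multiple of \<open>sqrt (ln M)\<close>, and a miss has probability at most
    \<open>M\<close> to the power \<open>- k\<close>.\<close>
  obtain s where s: "N0 < s" "s < 1 / r" using dense[OF r0(2)] by blast
  have s0: "0 < s" using s N0 by simp
  define k where "k = (sqrt (1 / r) - sqrt s)\<^sup>2 / N0"
  have k: "0 < k" using s N0 by (simp add: k_def)
  have lnM: "filterlim (\<lambda>n. ln (real (M n))) at_top sequentially"
    unfolding M_def
    by (intro filterlim_compose[OF ln_at_top] filterlim_compose[OF filterlim_real_sequentially]
        filterlim_div_at_top l few)
  have ex: "(\<lambda>n. exp (- c * ln (real (M n)))) \<longlonglongrightarrow> 0" if "0 < c" for c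
    by (intro filterlim_compose[OF exp_at_bot] filterlim_tendsto_neg_mult_at_bot[OF tendsto_const _ lnM])
      (use that in simp)
  have "(\<lambda>n. exp (- (s / N0 - 1) * ln (real (M n))) + exp (- k * ln (real (M n)))) \<longlonglongrightarrow> 0 + 0"
    using s N0 k by (intro tendsto_add ex) (auto simp: field_simps)
  then have "\<forall>\<^sub>F n in sequentially. exp (- (s / N0 - 1) * ln (real (M n))) + exp (- k * ln (real (M n))) < \<epsilon>"
    by (rule order_tendstoD) (use \<epsilon> in simp)
  moreover have "\<forall>\<^sub>F n in sequentially. 0 < ln (real (M n))"
    using filterlim_at_top_dense[THEN iffD1, OF lnM] by blast
  ultimately have "\<forall>\<^sub>F n in sequentially. \<exists>M E x g. APE_code N0 (\<alpha> n) (l n) n M E \<epsilon> x g \<and>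
      1 / (N0 * ln 2) - \<delta> < log 2 (real M) / E"
    using eventually_ge_at_top[of 1]
  proof eventually_elim
    case (elim n)
    define L where "L = ln (real (M n))"
    have L: "0 < L" using elim(2) by (simp add: L_def)
    then have M1: "1 \<le> M n" by (cases "M n = 0") (auto simp: L_def)
    have len: "l n * M n \<le> n" by (simp add: M_def mult.commute)
    define A where "A = sqrt (L / r)"
    define \<tau> where "\<tau> = sqrt (s * L)"
    have A: "0 < A" "A\<^sup>2 = L / r" using L r0 by (simp_all add: A_def)
    have "s * L \<le> L / r" using s L mult_right_mono[of s "1 / r" L] by simp
    then have \<tau>: "0 \<le> \<tau>" "\<tau> \<le> A" "\<tau>\<^sup>2 = s * L"
      using s0 L by (auto simp: \<tau>_def A_def)
    have "A - \<tau> = (sqrt (1 / r) - sqrt s) * sqrt L"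
      by (simp add: A_def \<tau>_def real_sqrt_mult real_sqrt_divide left_diff_distrib)
    then have A\<tau>: "(A - \<tau>)\<^sup>2 / N0 = k * L" using L by (simp add: k_def power_mult_distrib)
    have "real (M n) * exp (- \<tau>\<^sup>2 / N0) = exp (L - s / N0 * L)"
      using M1 by (simp add: L_def \<tau>(3)[unfolded L_def] exp_diff exp_minus field_simps)
    also have "L - s / N0 * L = - (s / N0 - 1) * L" by (simp add: algebra_simps)
    finally have err: "real (M n) * exp (- \<tau>\<^sup>2 / N0) + exp (- (A - \<tau>)\<^sup>2 / N0) < \<epsilon>"
      using elim(1) A\<tau> by (simp add: L_def)
    obtain x g where "APE_code N0 (\<alpha> n) (l n) n (M n) (A\<^sup>2)
        (real (M n) * exp (- \<tau>\<^sup>2 / N0) + exp (- (A - \<tau>)\<^sup>2 / N0)) x g"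
      using pulse_position_code[OF N0 l[OF elim(3)] _ _ M1 len \<tau>(1,2) A(1), of "\<alpha> n"] \<alpha>[OF elim(3)] by blast
    then have "APE_code N0 (\<alpha> n) (l n) n (M n) (A\<^sup>2) \<epsilon> x g"
      using err by (simp add: APE_code_def)
    moreover have "1 / (N0 * ln 2) - \<delta> < log 2 (real (M n)) / A\<^sup>2"
    proof -
      have "log 2 (real (M n)) / A\<^sup>2 = r / ln 2"
        unfolding A(2) log_def L_def[symmetric] using L by simp
      moreover have "(1 / N0 - \<delta> * ln 2) / ln 2 < r / ln 2"
        using r by (intro divide_strict_right_mono) auto
      ultimately show ?thesis by (simp add: diff_divide_distrib)
    qed
    ultimately show ?case by blast
  qed
  then show "\<exists>n0. \<forall>n\<ge>n0. \<exists>M E x g. APE_code N0 (\<alpha> n) (l n) n M E \<epsilon> x g \<and>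
      1 / (N0 * ln 2) - \<delta> < log 2 (real M) / E"
    by (simp add: eventually_sequentially)
qed

section \<open>Capacity per unit-energy\<close>

theorem theorem9:
  fixes N0 :: real and \<alpha> :: "nat \<Rightarrow> real" and l :: "nat \<Rightarrow> nat"
  assumes "N0 > 0"
    and "\<And>n. n \<ge> 1 \<Longrightarrow> l n \<ge> 1"
    and "\<And>n. n \<ge> 1 \<Longrightarrow> 0 < \<alpha> n \<and> \<alpha> n \<le> 1"
    and "liminf (\<lambda>n. ereal (\<alpha> n)) > 0"
  shows "((\<lambda>n. real (l n) / real n) \<longlonglongrightarrow> 0 \<longrightarrow> capacity_APE N0 \<alpha> l = ereal (log 2 (exp 1) / N0)) \<and>
    (liminf (\<lambda>n. ereal (real (l n) / real n)) > 0 \<longrightarrow> capacity_APE N0 \<alpha> l = 0)"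
proof (intro conjI impI)
  assume few: "(\<lambda>n. real (l n) / real n) \<longlonglongrightarrow> 0"
  \<comment> \<open>\<open>1 / (N0 * ln 2)\<close> is the claimed capacity with the base-2 logarithm
    written out; it is itself achievable, so the supremum is a maximum.\<close>
  have "Sup (ereal ` {R. achievable N0 \<alpha> l R}) = ereal (1 / (N0 * ln 2))"
  proof (rule Sup_eqI)
    show "y \<le> ereal (1 / (N0 * ln 2))" if "y \<in> ereal ` {R. achievable N0 \<alpha> l R}" for y
      using that achievable_le[OF assms] by auto
    show "ereal (1 / (N0 * ln 2)) \<le> y" if "\<And>z. z \<in> ereal ` {R. achievable N0 \<alpha> l R} \<Longrightarrow> z \<le> y" for y
      using that achievable_few_users[OF assms(1-3) few] by auto
  qed
  then show "capacity_APE N0 \<alpha> l = ereal (log 2 (exp 1) / N0)"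
    by (simp add: capacity_APE_def log_def mult.commute)
next
  assume many: "liminf (\<lambda>n. ereal (real (l n) / real n)) > 0"
  show "capacity_APE N0 \<alpha> l = 0"
    unfolding capacity_APE_def
  proof (rule Sup_eqI)
    show "y \<le> 0" if "y \<in> ereal ` {R. achievable N0 \<alpha> l R}" for y
      using that achievable_nonpos[OF assms many] by auto
    show "0 \<le> y" if "\<And>z. z \<in> ereal ` {R. achievable N0 \<alpha> l R} \<Longrightarrow> z \<le> y" for y
      using that[of "ereal 0"] achievable_zero[OF assms(1-3)] by (auto simp: zero_ereal_def)
  qed
qed

end
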